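(* Let $d\ge2$, let $H_1,\dots,H_d$ be Hilbert spaces (all real or all complex), let $\mathbf{H}=H_1\otimes\cdots\otimes H_d$ be their Hilbert space tensor product, and let $\mathbf{A}:\mathbf{H}\to\mathbf{H}$ be a bounded self-adjoint operator whose smallest spectral value $\lambda_1$ is a simple eigenvalue, with $$\lambda_1\|\mathbf{v}\|_{\mathbf{H}}^2\le\langle\mathbf{v},\mathbf{A}\mathbf{v}\rangle_{\mathbf{H}}\le\Gamma\|\mathbf{v}\|_{\mathbf{H}}^2\qquad\text{for all }\mathbf{v}\in\mathbf{H},$$ and such that the rest of the spectrum of $\mathbf{A}$ is contained in $[\lambda_2,\Gamma]$, where $\lambda_1<\lambda_2<\Gamma$. Set $$\delta=\lambda_2-\lambda_1,\qquad \Delta=\frac{\delta}{\Gamma-\lambda_1},\qquad q=\frac{1-\Delta}{1+\Delta}.$$ Let $t\subseteq\{1,\dots,d\}$ with $0<|t|<d$, let $t^c=\{1,\dots,d\}\setminus t$, and suppose that, with respect to the identification $\mathbf{H}\cong\big(\bigotimes_{\mu\in t}H_\mu\big)\otimes\big(\bigotimes_{\nu\in t^c}H_\nu\big)$, $$\mathbf{A}=\sum_{i=1}^{r_{\mathbf{A}}^{(t)}}A_i^{(t)}\otimes A_i^{(t^c)}$$ with bounded linear operators $A_i^{(t)}$ on $\bigotimes_{\mu\in t}H_\mu$ and $A_i^{(t^c)}$ on $\bigotimes_{\nu\in t^c}H_\nu$. Let $\mathbf{u}\ne\mathbf{0}$ be an eigenvector, $(\mathbf{A}-\lambda_1\mathbf{I})\mathbf{u}=\mathbf{0}$,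 and define $$\pi_1^{(t)}(\mathbf{u})=\inf\{\|\mathbf{v}-\mathbf{u}\|_{\mathbf{H}} : \mathbf{v}\in\mathbf{H},\ \langle\mathbf{v}-\mathbf{u},\mathbf{u}\rangle_{\mathbf{H}}=0,\ \operatorname{rank}^{(t)}(\mathbf{v})\le1\}.$$ Then for every integer $r\ge1$, $$\tau_r^{(t)}(\mathbf{u})\le\frac{\pi_1^{(t)}(\mathbf{u})}{q}\left(\frac1r\right)^{\left|\frac{\ln q}{\ln R^{(t)}}\right|}$$ with $R^{(t)}=r_{\mathbf{A}}^{(t)}+1$. If, additionally, $A_i^{(t)}$ or $A_i^{(t^c)}$ is the identity for some $i$, and $r_{\mathbf{A}}^{(t)}>1$, then the same bound holds with $R^{(t)}=r_{\mathbf{A}}^{(t)}$.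
   Context: For $\mathbf{v}\in\mathbf{H}$, the $t$-rank $\operatorname{rank}^{(t)}(\mathbf{v})$ is the rank of $\mathbf{v}$ viewed as an element of the two-fold tensor product $\big(\bigotimes_{\mu\in t}H_\mu\big)\otimes\big(\bigotimes_{\nu\notin t}H_\nu\big)$, i.e. the rank of the associated Hilbert–Schmidt operator (the number of its nonzero singular values $\sigma^{(t)}_1\ge\sigma^{(t)}_2\ge\dots\ge0$, possibly $\infty$). The best approximation error of $t$-rank at most $r$ is $$\tau_r^{(t)}(\mathbf{u})=\min_{\operatorname{rank}^{(t)}(\mathbf{v})\le r}\|\mathbf{u}-\mathbf{v}\|_{\mathbf{H}}=\Big(\sum_{k\ge r+1}(\sigma_k^{(t)})^2\Big)^{1/2},$$ where $\sigma_k^{(t)}$ are the singular values of $\mathbf{u}$ with respect to this splitting. *)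

theory Defs
  imports "HOL-Analysis.Analysis" "HOL-Library.Extended_Nat"
begin

(* The scalar field: these axioms hold for real (with the identity as conjugation) and for
   complex, and only for these two fields up to isomorphism. Theorems over this class treat
   the real and the complex case simultaneously. *)
class real_or_complex = real_normed_field +
  fixes conjugate :: "'a \<Rightarrow> 'a"
  assumes conjugate_add: "conjugate (x + y) = conjugate x + conjugate y"
    and conjugate_mult: "conjugate (x * y) = conjugate x * conjugate y"
    and conjugate_conjugate: "conjugate (conjugate x) = x"
    and conjugate_mult_self: "conjugate x * x = ((norm x)\<^sup>2) *\<^sub>R 1"

instantiation real :: real_or_complex
begin

definition conjugate_real :: "real \<Rightarrow> real" where
  "conjugate_real x = x"

instance
  by standard (auto simp: conjugate_real_def power2_eq_square)

end

instantiation complex :: real_or_complex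
begin

definition conjugate_complex :: "complex \<Rightarrow> complex" where
  "conjugate_complex = cnj"

instance
proof
  fix x :: complex
  show "conjugate x * x = (norm x)\<^sup>2 *\<^sub>R 1"
    using complex_norm_square[of x]
    by (simp add: conjugate_complex_def mult.commute scaleR_conv_of_real)
qed (auto simp: conjugate_complex_def)

end

(* A Hilbert space over 'k is given by a type of class banach, which supplies addition, norm
   and completeness, together with the scalar multiplication and the inner product collected
   in the following record. *)
record ('k, 'v) hilbert_struct =
  scale :: "'k \<Rightarrow> 'v \<Rightarrow> 'v"
  ip :: "'v \<Rightarrow> 'v \<Rightarrow> 'k"

locale hilbert_space =
  fixes X :: "('k::real_or_complex, 'v::banach) hilbert_struct"
  assumes vector_space_scale: "vector_space (scale X)"
    and scale_of_real: "scale X (of_real c) x = c *\<^sub>R x"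
    and ip_add_right: "ip X x (y + z) = ip X x y + ip X x z"
    and ip_scale_right: "ip X x (scale X a y) = a * ip X x y"
    and ip_commute: "ip X y x = conjugate (ip X x y)"
    and ip_self: "ip X x x = of_real ((norm x)\<^sup>2)"

definition bounded_operator ::
    "('k::real_or_complex, 'v::banach) hilbert_struct \<Rightarrow> ('v \<Rightarrow> 'v) \<Rightarrow> bool" where
  "bounded_operator X A \<longleftrightarrow>
     bounded_linear A \<and> (\<forall>c x. A (scale X c x) = scale X c (A x))"

definition self_adjoint ::
    "('k::real_or_complex, 'v::banach) hilbert_struct \<Rightarrow> ('v \<Rightarrow> 'v) \<Rightarrow> bool" where
  "self_adjoint X A \<longleftrightarrow> (\<forall>x y. ip X (A x) y = ip X x (A y))"

definition spectrum ::
    "('k::real_or_complex, 'v::banach) hilbert_struct \<Rightarrow> ('v \<Rightarrow> 'v) \<Rightarrow> 'k set" where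
  "spectrum X A =
     {z. \<not> (\<exists>B. bounded_operator X B \<and>
               (\<forall>x. B (A x - scale X z x) = x) \<and>
               (\<forall>x. A (B x) - scale X z (B x) = x))}"

definition eigenspace ::
    "('k::real_or_complex, 'v::banach) hilbert_struct \<Rightarrow> ('v \<Rightarrow> 'v) \<Rightarrow> 'k \<Rightarrow> 'v set" where
  "eigenspace X A z = {x. A x = scale X z x}"

(* X with the map tens is the Hilbert space tensor product of the closed subspaces H i
   (i in I) of E: tens is multilinear, satisfies the defining inner product identity, and
   the elementary tensors have dense span. Hence tens induces an isometric embedding of the
   algebraic tensor product with dense range, i.e. the complete space X is its completion.
   Tuples are functions on the index type of which only the values on I matter.
   Taking the factors as closed subspaces of one space E is no restriction: any family of
   Hilbert spaces embeds isometrically into its Hilbert space direct sum. *)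
definition hilbert_tensor ::
    "('k::real_or_complex, 'a::banach) hilbert_struct \<Rightarrow> 'i set \<Rightarrow> ('i \<Rightarrow> 'a set) \<Rightarrow>
     ('k, 'v::banach) hilbert_struct \<Rightarrow> (('i \<Rightarrow> 'a) \<Rightarrow> 'v) \<Rightarrow> bool" where
  "hilbert_tensor E I H X tens \<longleftrightarrow>
     (\<forall>x\<in>Pi I H. \<forall>i\<in>I. \<forall>y\<in>H i. \<forall>z\<in>H i. \<forall>c.
        tens (x(i := scale E c y + z)) = scale X c (tens (x(i := y))) + tens (x(i := z))) \<and>
     (\<forall>x\<in>Pi I H. \<forall>y\<in>Pi I H. ip X (tens x) (tens y) = (\<Prod>i\<in>I. ip E (x i) (y i))) \<and>
     closure (module.span (scale X) (tens ` Pi I H)) = UNIV"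

(* The same for two factors, which may live on different types. *)
definition hilbert_tensor2 ::
    "('k::real_or_complex, 'p::banach) hilbert_struct \<Rightarrow> ('k, 'q::banach) hilbert_struct \<Rightarrow>
     ('k, 'v::banach) hilbert_struct \<Rightarrow> ('p \<Rightarrow> 'q \<Rightarrow> 'v) \<Rightarrow> bool" where
  "hilbert_tensor2 P Q X tens2 \<longleftrightarrow>
     (\<forall>c p p' q. tens2 (scale P c p + p') q = scale X c (tens2 p q) + tens2 p' q) \<and>
     (\<forall>c p q q'. tens2 p (scale Q c q + q') = scale X c (tens2 p q) + tens2 p q') \<and>
     (\<forall>p q p' q'. ip X (tens2 p q) (tens2 p' q') = ip P p p' * ip Q q q') \<and>
     closure (module.span (scale X) {tens2 p q | p q. True}) = UNIV"

(* For bounded S and T such a bounded operator C exists; it is unique since the elementary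
   tensors have dense span. *)
definition tensor_operator ::
    "('k::real_or_complex, 'v::banach) hilbert_struct \<Rightarrow> ('p \<Rightarrow> 'q \<Rightarrow> 'v) \<Rightarrow>
     ('p \<Rightarrow> 'p) \<Rightarrow> ('q \<Rightarrow> 'q) \<Rightarrow> 'v \<Rightarrow> 'v" where
  "tensor_operator X tens2 S T =
     (THE C. bounded_operator X C \<and> (\<forall>p q. C (tens2 p q) = tens2 (S p) (T q)))"

(* The Hilbert-Schmidt operator associated with v, as the contraction of v with the
   functional given by p; it maps p to ip P p p0 times q0 if v = tens2 p0 q0. It is linear
   as a function of the functional, hence conjugate-linear in p. *)
definition hs_operator ::
    "('k::real_or_complex, 'q::banach) hilbert_struct \<Rightarrow> ('k, 'v::banach) hilbert_struct \<Rightarrow>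
     ('p \<Rightarrow> 'q \<Rightarrow> 'v) \<Rightarrow> 'v \<Rightarrow> 'p \<Rightarrow> 'q" where
  "hs_operator Q X tens2 v p = (THE w. \<forall>y. ip Q y w = ip X (tens2 p y) v)"

(* The library's dim is 0 on infinite-dimensional subspaces, hence the case distinction. *)
definition tensor_rank ::
    "('k::real_or_complex, 'q::banach) hilbert_struct \<Rightarrow> ('k, 'v::banach) hilbert_struct \<Rightarrow>
     ('p \<Rightarrow> 'q \<Rightarrow> 'v) \<Rightarrow> 'v \<Rightarrow> enat" where
  "tensor_rank Q X tens2 v =
     (let W = range (hs_operator Q X tens2 v) in
      if \<exists>B. finite B \<and> W \<subseteq> module.span (scale Q) B
      then enat (vector_space.dim (scale Q) W) else \<infinity>)"

(* The infimum is a minimum, by the singular value decomposition of hs_operator. *)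
definition best_error ::
    "('k::real_or_complex, 'q::banach) hilbert_struct \<Rightarrow> ('k, 'v::banach) hilbert_struct \<Rightarrow>
     ('p \<Rightarrow> 'q \<Rightarrow> 'v) \<Rightarrow> nat \<Rightarrow> 'v \<Rightarrow> real" where
  "best_error Q X tens2 r u = Inf {norm (u - v) | v. tensor_rank Q X tens2 v \<le> enat r}"

definition rank_one_distance ::
    "('k::real_or_complex, 'q::banach) hilbert_struct \<Rightarrow> ('k, 'v::banach) hilbert_struct \<Rightarrow>
     ('p \<Rightarrow> 'q \<Rightarrow> 'v) \<Rightarrow> 'v \<Rightarrow> real" where
  "rank_one_distance Q X tens2 u =
     Inf {norm (v - u) | v. ip X (v - u) u = 0 \<and> tensor_rank Q X tens2 v \<le> 1}"

end

theory Submission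
  imports Defs
begin

text \<open>
  Let \<open>\<Phi> = I - \<alpha> (A - \<lambda>\<^sub>1 I)\<close> with \<open>\<alpha> = 2 / (\<delta> + \<Gamma> - \<lambda>\<^sub>1)\<close>. It fixes \<open>u\<close> and contracts the orthogonal
  complement of \<open>u\<close> by the factor \<open>q\<close>, while it multiplies the rank by at most \<open>R\<close>. Iterating it
  on a rank-one \<open>v\<close> with \<open>v - u \<bottom> u\<close> gives an approximation of rank at most \<open>R\<^sup>n\<close> and error at most
  \<open>q\<^sup>n \<parallel>v - u\<parallel>\<close>; choose \<open>n\<close> with \<open>R\<^sup>n \<le> r < R\<^sup>n\<^sup>+\<^sup>1\<close>. The contraction uses the spectrum only through
  bounded invertibility of \<open>A - s\<close> for \<open>s\<close> in the gap, so no functional calculus is needed; it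
  is proved for the underlying real Hilbert space.
\<close>

subsection \<open>Real inner products and spectral gaps\<close>

lemma quadratic_nonneg_discriminant:
  fixes a b c :: real
  assumes "\<And>s. 0 \<le> a + 2 * b * s + c * s\<^sup>2" and "0 \<le> c"
  shows "b\<^sup>2 \<le> a * c"
proof (cases "c = 0")
  case True
  have "b = 0"
  proof (rule ccontr)
    assume "b \<noteq> 0"
    then show False using assms(1)[of "- (a + 1) / (2 * b)"] True by simp
  qed
  then show ?thesis using True by simp
next
  case False
  then have "0 < c" using assms(2) by simp
  have "0 \<le> a + 2 * b * (- b / c) + c * (- b / c)\<^sup>2" by (rule assms(1))
  also have "\<dots> = (a * c - b\<^sup>2) / c" using \<open>0 < c\<close> by (simp add: field_simps power2_eq_square)
  finally show ?thesis using \<open>0 < c\<close> by (simp add: zero_le_divide_iff)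
qed

locale real_inner_product =
  fixes g :: "'v::banach \<Rightarrow> 'v \<Rightarrow> real"
  assumes add_right: "g x (y + z) = g x y + g x z"
    and scaleR_right: "g x (c *\<^sub>R y) = c * g x y"
    and sym: "g x y = g y x"
    and self: "g x x = (norm x)\<^sup>2"
begin

lemma add_left: "g (x + y) z = g x z + g y z"
  by (metis add_right sym)

lemma scaleR_left: "g (c *\<^sub>R x) y = c * g x y"
  by (metis scaleR_right sym)

lemma zero_right [simp]: "g x 0 = 0"
  using scaleR_right[of x 0 0] by simp

lemma zero_left [simp]: "g 0 x = 0"
  by (metis zero_right sym)

lemma minus_right: "g x (- y) = - g x y"
  using scaleR_right[of x "-1" y] by simp

lemma diff_right: "g x (y - z) = g x y - g x z"
  using add_right[of x y "- z"] by (simp add: minus_right)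

lemma diff_left: "g (x - y) z = g x z - g y z"
  by (metis diff_right sym)

lemmas ip_simps = add_left add_right diff_left diff_right scaleR_left scaleR_right

lemma norm_add_squared: "(norm (x + y))\<^sup>2 = (norm x)\<^sup>2 + 2 * g x y + (norm y)\<^sup>2"
  by (simp add: self[symmetric] ip_simps sym[of y x])

lemma norm_diff_squared: "(norm (x - y))\<^sup>2 = (norm x)\<^sup>2 - 2 * g x y + (norm y)\<^sup>2"
  by (simp add: self[symmetric] ip_simps sym[of y x])

lemma semidefinite_Cauchy_Schwarz:
  assumes K: "linear K" "\<And>x y. g (K x) y = g x (K y)"
    and M: "subspace M" "\<And>x. x \<in> M \<Longrightarrow> 0 \<le> g x (K x)"
    and xy: "x \<in> M" "y \<in> M"
  shows "(g x (K y))\<^sup>2 \<le> g x (K x) * g y (K y)"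
proof (rule quadratic_nonneg_discriminant)
  fix s
  have "x + s *\<^sub>R y \<in> M" using M(1) xy by (simp add: subspace_def)
  then have "0 \<le> g (x + s *\<^sub>R y) (K (x + s *\<^sub>R y))" by (rule M(2))
  also have "\<dots> = g x (K x) + 2 * g x (K y) * s + g y (K y) * s\<^sup>2"
    using K(2)[of x y] sym[of y "K x"]
    by (simp add: linear_add[OF K(1)] linear_scale[OF K(1)] ip_simps
        power2_eq_square algebra_simps)
  finally show "0 \<le> g x (K x) + 2 * g x (K y) * s + g y (K y) * s\<^sup>2" .
qed (use M(2) xy in simp)

lemma Cauchy_Schwarz: "\<bar>g x y\<bar> \<le> norm x * norm y"
proof -
  have "(g x y)\<^sup>2 \<le> (norm x * norm y)\<^sup>2"
    using semidefinite_Cauchy_Schwarz[of "\<lambda>x. x" UNIV x y]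
    by (simp add: self linear_id[unfolded id_def] power_mult_distrib)
  then show ?thesis by (metis abs_le_square_iff abs_of_nonneg mult_nonneg_nonneg norm_ge_zero)
qed

lemma semidefinite_norm_bound:
  assumes K: "linear K" "\<And>x y. g (K x) y = g x (K y)"
    and M: "subspace M" "\<And>x. x \<in> M \<Longrightarrow> 0 \<le> g x (K x)" "\<And>x. x \<in> M \<Longrightarrow> K x \<in> M"
    and L: "\<And>x. x \<in> M \<Longrightarrow> g x (K x) \<le> L * (norm x)\<^sup>2"
    and x: "x \<in> M"
  shows "(norm (K x))\<^sup>2 \<le> L * g x (K x)"
proof (cases "K x = 0")
  case False
  have "((norm (K x))\<^sup>2)\<^sup>2 = (g x (K (K x)))\<^sup>2" by (simp add: K(2)[symmetric] self)
  also have "\<dots> \<le> g x (K x) * g (K x) (K (K x))"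
    by (rule semidefinite_Cauchy_Schwarz) (use assms in auto)
  also have "\<dots> \<le> g x (K x) * (L * (norm (K x))\<^sup>2)"
    by (intro mult_left_mono L M x)
  finally have "(norm (K x))\<^sup>2 * (norm (K x))\<^sup>2 \<le> (L * g x (K x)) * (norm (K x))\<^sup>2"
    by (simp add: power2_eq_square algebra_simps)
  then show ?thesis by (rule mult_right_le_imp_le) (use False in simp)
qed simp

lemma exists_min_norm:
  fixes M :: "'v set"
  assumes "closed M" "convex M" "M \<noteq> {}"
  shows "\<exists>z\<in>M. \<forall>y\<in>M. norm z \<le> norm y"
proof -
  define m where "m = Inf ((\<lambda>y. (norm y)\<^sup>2) ` M)"
  have bdd: "bdd_below ((\<lambda>y. (norm y)\<^sup>2) ` M)" by (rule bdd_belowI2[of _ 0]) simp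
  have m: "m \<le> (norm y)\<^sup>2" if "y \<in> M" for y
    unfolding m_def by (rule cINF_lower[OF bdd that])
  define N where "N n = {y \<in> M. (norm y)\<^sup>2 \<le> m + 1 / real (Suc n)}" for n
  have close: "(dist x y)\<^sup>2 \<le> 4 / real (Suc n)" if "x \<in> N n" "y \<in> N n" for x y n
  proof -
    have "(1/2) *\<^sub>R x + (1/2) *\<^sub>R y \<in> M"
      using that \<open>convex M\<close> by (intro convexD) (auto simp: N_def)
    then have "m \<le> (norm ((1/2) *\<^sub>R (x + y)))\<^sup>2" by (simp add: m scaleR_add_right)
    then have "4 * m \<le> (norm (x + y))\<^sup>2" by (simp add: power2_eq_square)
    then show ?thesis using that norm_add_squared[of x y] norm_diff_squared[of x y]
      by (simp add: N_def dist_norm add_divide_distrib)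
  qed
  obtain z where z: "\<And>n. z \<in> N n"
  proof (rule decreasing_closed_nest[of N])
    show "closed (N n)" for n
    proof -
      have "N n = M \<inter> {y. (norm y)\<^sup>2 \<le> m + 1 / real (Suc n)}" by (auto simp: N_def)
      then show ?thesis
        using \<open>closed M\<close> by (auto intro!: closed_Int closed_Collect_le continuous_intros)
    qed
    show "N n \<noteq> {}" for n
    proof -
      have "m < m + 1 / real (Suc n)" by simp
      then obtain y where "y \<in> M" "(norm y)\<^sup>2 < m + 1 / real (Suc n)"
        unfolding m_def using cInf_lessD[of "(\<lambda>y. (norm y)\<^sup>2) ` M"] assms(3) by blast
      then show ?thesis by (auto simp: N_def)
    qed
    show "N n \<subseteq> N k" if "k \<le> n" for k n
    proof -
      have "1 / real (Suc n) \<le> 1 / real (Suc k)" using that by (simp add: field_simps)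
      then show ?thesis by (auto simp: N_def)
    qed
    show "\<exists>n. \<forall>x\<in>N n. \<forall>y\<in>N n. dist x y < e" if "e > 0" for e
    proof -
      obtain n where n: "4 / e\<^sup>2 < real n" using reals_Archimedean2 by blast
      have "dist x y < e" if "x \<in> N n" "y \<in> N n" for x y
      proof -
        have "4 / real (Suc n) < e\<^sup>2"
          using n \<open>e > 0\<close> by (simp add: field_simps) (smt (verit) zero_less_power)
        then have "(dist x y)\<^sup>2 < e\<^sup>2" using close[OF that] by linarith
        then show ?thesis by (rule power_less_imp_less_base) (use \<open>e > 0\<close> in simp)
      qed
      then show ?thesis by blast
    qed
  qed blast
  have "norm z \<le> norm y" if "y \<in> M" for y
  proof -
    have "(norm z)\<^sup>2 \<le> m"
    proof (rule field_le_epsilon)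
      fix e :: real assume "e > 0"
      then obtain n where "1 / real (Suc n) < e" using nat_approx_posE by blast
      then show "(norm z)\<^sup>2 \<le> m + e" using z[of n] by (simp add: N_def)
    qed
    then have "(norm z)\<^sup>2 \<le> (norm y)\<^sup>2" using m[OF that] by linarith
    then show ?thesis by (rule power2_le_imp_le) simp
  qed
  then show ?thesis using z[of 0] by (auto simp: N_def)
qed

lemma min_norm_orthogonal:
  assumes "\<And>s. norm z \<le> norm (z + s *\<^sub>R h)"
  shows "g z h = 0"
proof -
  have "(g z h)\<^sup>2 \<le> 0 * (norm h)\<^sup>2"
  proof (rule quadratic_nonneg_discriminant)
    fix s
    have "(norm z)\<^sup>2 \<le> (norm (z + s *\<^sub>R h))\<^sup>2" by (simp add: assms power_mono)
    then show "0 \<le> 0 + 2 * g z h * s + (norm h)\<^sup>2 * s\<^sup>2"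
      by (simp add: norm_add_squared ip_simps power_mult_distrib algebra_simps)
  qed simp
  then show ?thesis by simp
qed

lemma exists_orthogonal_projection:
  assumes "closed M" "subspace M"
  shows "\<exists>y\<in>M. \<forall>h\<in>M. g (v - y) h = 0"
proof -
  let ?N = "(\<lambda>y. v - y) ` M"
  have "closed ?N"
    using closed_translation[OF closed_negations[OF assms(1)], of v]
    by (simp add: image_image)
  moreover have "convex ?N"
    using convex_translation[OF convex_negations[OF subspace_imp_convex[OF assms(2)]], of v]
    by (simp add: image_image)
  moreover have "?N \<noteq> {}" using subspace_0[OF assms(2)] by auto
  ultimately obtain y where y: "y \<in> M" "\<And>x. x \<in> M \<Longrightarrow> norm (v - y) \<le> norm (v - x)"
    using exists_min_norm[of ?N] by auto
  have "g (v - y) h = 0" if "h \<in> M" for h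
  proof (rule min_norm_orthogonal)
    fix s
    have "y - s *\<^sub>R h \<in> M" using assms(2) y(1) that by (simp add: subspace_diff subspace_scale)
    from y(2)[OF this] show "norm (v - y) \<le> norm (v - y + s *\<^sub>R h)" by (simp add: algebra_simps)
  qed
  then show ?thesis using y(1) by blast
qed

end

lemma subspace_closure:
  fixes M :: "'v::real_normed_vector set"
  assumes "subspace M"
  shows "subspace (closure M)"
  unfolding subspace_def
proof (intro conjI ballI allI)
  show "0 \<in> closure M" using subspace_0[OF assms] closure_subset by blast
  show "x + y \<in> closure M" if xy: "x \<in> closure M" "y \<in> closure M" for x y
  proof -
    obtain a b where "\<And>n. a n \<in> M" "a \<longlonglongrightarrow> x" "\<And>n. b n \<in> M" "b \<longlonglongrightarrow> y"
      using xy unfolding closure_sequential by blast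
    then show ?thesis unfolding closure_sequential
      by (intro exI[of _ "\<lambda>n. a n + b n"]) (auto intro: tendsto_add subspace_add[OF assms])
  qed
  show "c *\<^sub>R x \<in> closure M" if x: "x \<in> closure M" for c x
  proof -
    obtain a where "\<And>n. a n \<in> M" "a \<longlonglongrightarrow> x" using x unfolding closure_sequential by blast
    then show ?thesis unfolding closure_sequential
      by (intro exI[of _ "\<lambda>n. c *\<^sub>R a n"])
        (auto intro: tendsto_scaleR tendsto_const subspace_scale[OF assms])
  qed
qed

context real_inner_product
begin

lemma bounded_below_compose:
  fixes F G :: "'v \<Rightarrow> 'v"
  assumes "\<exists>c>0. \<forall>x. c * norm x \<le> norm (F x)" "\<exists>c>0. \<forall>x. c * norm x \<le> norm (G x)"
  shows "\<exists>c>0. \<forall>x. c * norm x \<le> norm (F (G x))"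
proof -
  obtain c c' where c: "c > 0" "\<And>x. c * norm x \<le> norm (F x)"
    and c': "c' > 0" "\<And>x. c' * norm x \<le> norm (G x)" using assms by blast
  have "c * c' * norm x \<le> norm (F (G x))" for x
    using mult_left_mono[OF c'(2)[of x], of c] c(1) c(2)[of "G x"]
    unfolding mult.assoc by linarith
  then show ?thesis using c(1) c'(1) by (intro exI[of _ "c * c'"]) simp
qed

text \<open>If the infimum \<open>m\<close> of the numerical range of \<open>D (D - \<delta>)\<close> were negative, then
  \<open>D (D - \<delta>) - m\<close> would factor into \<open>(D - a) (D - b)\<close> with \<open>a\<close>, \<open>b\<close> in the spectral gap
  and so be bounded below, contradicting the minimality of \<open>m\<close>.\<close>

lemma spectral_gap_squared:
  assumes D: "bounded_linear D" "\<And>x y. g (D x) y = g x (D y)" and "0 < \<delta>"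
    and gap: "\<And>s. 0 < s \<Longrightarrow> s < \<delta> \<Longrightarrow> \<exists>c>0. \<forall>x. c * norm x \<le> norm (D x - s *\<^sub>R x)"
  shows "\<delta> * g x (D x) \<le> (norm (D x))\<^sup>2"
proof (rule ccontr)
  interpret D: bounded_linear D by (rule D(1))
  define C where "C x = D (D x) - \<delta> *\<^sub>R D x" for x
  have gC: "g x (C x) = (norm (D x))\<^sup>2 - \<delta> * g x (D x)" for x
    unfolding C_def by (simp add: ip_simps D(2)[symmetric] self)
  have C: "bounded_linear C"
    unfolding C_def using D.bounded_linear_axioms
    by (intro bounded_linear_sub bounded_linear_compose[of D D] bounded_linear_compose[OF bounded_linear_scaleR_right])
  interpret C: bounded_linear C by (rule C)
  have lower: "- (\<delta>\<^sup>2 / 4) \<le> g x (C x)" if "norm x = 1" for x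
  proof -
    have "0 \<le> (norm (D x - (\<delta>/2) *\<^sub>R x))\<^sup>2" by simp
    also have "\<dots> = g x (C x) + \<delta>\<^sup>2 / 4"
      using that sym[of "D x" x]
      by (simp add: norm_diff_squared gC ip_simps power_mult_distrib power_divide)
    finally show ?thesis by simp
  qed
  define U where "U = {x::'v. norm x = 1}"
  define m where "m = (INF x\<in>U. g x (C x))"
  assume "\<not> ?thesis"
  then have neg: "g x (C x) < 0" by (simp add: gC)
  then have "x \<noteq> 0" by auto
  define y where "y = (1 / norm x) *\<^sub>R x"
  have "g y (C y) = (1 / norm x)\<^sup>2 * g x (C x)"
    by (simp add: y_def C.scaleR ip_simps power2_eq_square)
  moreover have "0 < (1 / norm x)\<^sup>2" using \<open>x \<noteq> 0\<close> by simp
  ultimately have y: "y \<in> U" "g y (C y) < 0"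
    using \<open>x \<noteq> 0\<close> mult_pos_neg[OF _ neg] by (auto simp: y_def U_def)
  have bdd: "bdd_below ((\<lambda>x. g x (C x)) ` U)"
    using lower by (intro bdd_belowI2[of _ "- (\<delta>\<^sup>2 / 4)"]) (simp add: U_def)
  have m_le: "m \<le> g z (C z)" if "z \<in> U" for z
    unfolding m_def by (rule cINF_lower[OF bdd that])
  have m: "- (\<delta>\<^sup>2 / 4) \<le> m" "m < 0"
  proof -
    show "- (\<delta>\<^sup>2 / 4) \<le> m" unfolding m_def
      by (rule cINF_greatest) (use y lower in \<open>auto simp: U_def\<close>)
    show "m < 0" using m_le[OF y(1)] y(2) by linarith
  qed
  define K where "K x = C x - m *\<^sub>R x" for x
  have K: "bounded_linear K"
    unfolding K_def using C
    by (intro bounded_linear_sub bounded_linear_scaleR_right)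
  interpret K: bounded_linear K by (rule K)
  define \<rho> where "\<rho> = sqrt (\<delta>\<^sup>2 / 4 + m)"
  have \<rho>: "0 \<le> \<rho>" "\<rho>\<^sup>2 = \<delta>\<^sup>2 / 4 + m" using m(1) by (auto simp: \<rho>_def)
  have "\<rho>\<^sup>2 < (\<delta> / 2)\<^sup>2" using m(2) \<rho>(2) by (simp add: power_divide)
  then have "\<rho> < \<delta> / 2" by (rule power_less_imp_less_base) (use \<open>0 < \<delta>\<close> in simp)
  define a b where "a = \<delta> / 2 + \<rho>" and "b = \<delta> / 2 - \<rho>"
  have ab: "a + b = \<delta>" "a * b = - m" "0 < a" "a < \<delta>" "0 < b" "b < \<delta>"
    using \<rho> \<open>\<rho> < \<delta> / 2\<close> \<open>0 < \<delta>\<close> by (auto simp: a_def b_def power2_eq_square algebra_simps)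
  have "K = (\<lambda>x. D (D x - b *\<^sub>R x) - a *\<^sub>R (D x - b *\<^sub>R x))"
  proof
    fix x
    have "D (D x - b *\<^sub>R x) - a *\<^sub>R (D x - b *\<^sub>R x) = D (D x) - (a + b) *\<^sub>R D x + (a * b) *\<^sub>R x"
      by (simp add: D.diff D.scaleR scaleR_diff_right scaleR_add_left)
    then show "K x = D (D x - b *\<^sub>R x) - a *\<^sub>R (D x - b *\<^sub>R x)"
      by (simp add: ab K_def C_def)
  qed
  then have "\<exists>c>0. \<forall>x. c * norm x \<le> norm (K x)"
    using bounded_below_compose[of "\<lambda>x. D x - a *\<^sub>R x" "\<lambda>x. D x - b *\<^sub>R x", OF gap gap] ab
    by blast
  then obtain c where c: "c > 0" "\<And>x. c * norm x \<le> norm (K x)" by blast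
  define L where "L = onorm K + 1"
  have "L > 0" using onorm_pos_le[OF K] by (simp add: L_def)
  have K_le: "g x (K x) \<le> L * (norm x)\<^sup>2" for x
  proof -
    have "g x (K x) \<le> norm x * norm (K x)" using Cauchy_Schwarz[of x "K x"] by linarith
    also have "\<dots> \<le> norm x * (L * norm x)"
      using onorm[OF K, of x] by (intro mult_left_mono) (auto simp: L_def algebra_simps intro: add_increasing)
    finally show ?thesis by (simp add: power2_eq_square algebra_simps)
  qed
  have K_nonneg: "0 \<le> g x (K x)" for x
  proof (cases "x = 0")
    case False
    have "g ((1 / norm x) *\<^sub>R x) (C ((1 / norm x) *\<^sub>R x)) = g x (C x) / (norm x)\<^sup>2"
      by (simp add: C.scaleR ip_simps power2_eq_square)
    then have "g x (K x) = (norm x)\<^sup>2 * (g ((1 / norm x) *\<^sub>R x) (C ((1 / norm x) *\<^sub>R x)) - m)"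
      using False by (simp add: K_def ip_simps self right_diff_distrib)
    moreover have "m \<le> g ((1 / norm x) *\<^sub>R x) (C ((1 / norm x) *\<^sub>R x))"
      by (rule m_le) (use False in \<open>simp add: U_def\<close>)
    ultimately show ?thesis by simp
  qed simp
  have K_sym: "g (K x) y = g x (K y)" for x y
    by (simp add: K_def C_def ip_simps D(2))
  have "m + c\<^sup>2 / L \<le> m"
  proof (subst (2) m_def, rule cINF_greatest)
    fix z assume "z \<in> U"
    have "c\<^sup>2 \<le> (norm (K z))\<^sup>2"
      using c(2)[of z] \<open>z \<in> U\<close> c(1) by (intro power_mono) (auto simp: U_def)
    also have "\<dots> \<le> L * g z (K z)"
      by (rule semidefinite_norm_bound[of K UNIV])
        (use K.linear_axioms K_sym K_nonneg K_le in auto)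
    also have "g z (K z) = g z (C z) - m"
      using \<open>z \<in> U\<close> by (simp add: K_def ip_simps self U_def)
    finally show "m + c\<^sup>2 / L \<le> g z (C z)" using \<open>L > 0\<close> by (simp add: field_simps)
  qed (use y in auto)
  then show False using c(1) \<open>L > 0\<close> by (simp add: divide_le_0_iff)
qed

text \<open>On vectors \<open>D x\<close> this is Cauchy--Schwarz for the form of \<open>D\<close>, and these vectors are dense
  in the orthogonal complement of the kernel.\<close>

lemma spectral_gap_lower_bound:
  assumes D: "bounded_linear D" "\<And>x y. g (D x) y = g x (D y)" "\<And>x. 0 \<le> g x (D x)"
    and "0 < \<delta>"
    and gap: "\<And>s. 0 < s \<Longrightarrow> s < \<delta> \<Longrightarrow> \<exists>c>0. \<forall>x. c * norm x \<le> norm (D x - s *\<^sub>R x)"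
    and v: "\<And>w. D w = 0 \<Longrightarrow> g v w = 0"
  shows "\<delta> * (norm v)\<^sup>2 \<le> g v (D v)"
proof -
  interpret D: bounded_linear D by (rule D(1))
  have range_bound: "\<delta> * (norm (D x))\<^sup>2 \<le> g (D x) (D (D x))" for x
  proof (cases "D x = 0")
    case False
    have CS: "(g x (D y))\<^sup>2 \<le> g x (D x) * g y (D y)" for x y
      by (rule semidefinite_Cauchy_Schwarz[of D UNIV])
        (use D.linear_axioms D in auto)
    have sq: "((norm (D x))\<^sup>2)\<^sup>2 \<le> g x (D x) * g (D x) (D (D x))"
      using CS[of x "D x"] by (simp add: D(2)[symmetric] self)
    then have "g x (D x) \<noteq> 0" using False by auto
    then have pos: "0 < g x (D x)" using D(3)[of x] by simp
    have "g x (D x) * (\<delta> * (norm (D x))\<^sup>2) = (\<delta> * g x (D x)) * (norm (D x))\<^sup>2" by simp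
    also have "\<dots> \<le> (norm (D x))\<^sup>2 * (norm (D x))\<^sup>2"
      by (intro mult_right_mono spectral_gap_squared) (use D \<open>0 < \<delta>\<close> gap in auto)
    also have "\<dots> \<le> g x (D x) * g (D x) (D (D x))" using sq by (simp add: power2_eq_square)
    finally show ?thesis using pos by simp
  qed (simp add: D.zero)
  define M where "M = closure (range D)"
  have gD: "continuous_on UNIV (\<lambda>y. g y (D y))"
  proof -
    have "(\<lambda>y. g y (D y)) = (\<lambda>y. ((norm (y + D y))\<^sup>2 - (norm (y - D y))\<^sup>2) / 4)"
      by (simp add: norm_add_squared norm_diff_squared)
    then show ?thesis by (simp only:) (intro continuous_intros D.continuous_on, simp)
  qed
  have "M \<subseteq> {y. \<delta> * (norm y)\<^sup>2 \<le> g y (D y)}"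
    unfolding M_def
    by (rule closure_minimal) (use range_bound gD in \<open>auto intro!: closed_Collect_le continuous_intros\<close>)
  moreover have "v \<in> M"
  proof -
    have M: "closed M" "subspace M"
      by (auto simp: M_def intro!: subspace_closure linear_subspace_image D.linear_axioms)
    then obtain y where y: "y \<in> M" "\<And>h. h \<in> M \<Longrightarrow> g (v - y) h = 0"
      using exists_orthogonal_projection by blast
    have "g (D (v - y)) (D (v - y)) = 0"
      unfolding D(2)[of "v - y"] by (rule y(2)) (simp add: M_def closure_subset[THEN subsetD])
    then have ker: "D (v - y) = 0" by (simp add: self)
    have "g v (v - y) = 0" using v ker by simp
    then have "g (v - y) (v - y) = 0" using y by (simp add: diff_left sym[of y "v - y"])
    then show ?thesis using y(1) by (simp add: self)
  qed
  ultimately show ?thesis by auto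
qed

theorem spectral_gap_contraction:
  assumes D: "bounded_linear D" "\<And>x y. g (D x) y = g x (D y)" "\<And>x. 0 \<le> g x (D x)"
    and G: "\<And>x. g x (D x) \<le> G * (norm x)\<^sup>2" and "0 < \<delta>" "\<delta> \<le> G"
    and gap: "\<And>s. 0 < s \<Longrightarrow> s < \<delta> \<Longrightarrow> \<exists>c>0. \<forall>x. c * norm x \<le> norm (D x - s *\<^sub>R x)"
    and v: "\<And>w. D w = 0 \<Longrightarrow> g v w = 0"
  shows "norm (v - (2 / (\<delta> + G)) *\<^sub>R D v) \<le> (G - \<delta>) / (G + \<delta>) * norm v"
proof -
  interpret D: bounded_linear D by (rule D(1))
  define M where "M = {v. \<forall>w. D w = 0 \<longrightarrow> g v w = 0}"
  have M: "subspace M" by (auto simp: M_def subspace_def ip_simps)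
  have DM: "D x \<in> M" for x by (simp add: M_def D(2))
  define K where "K x = D x - \<delta> *\<^sub>R x" for x
  have "(norm (K v))\<^sup>2 \<le> (G - \<delta>) * g v (K v)"
  proof (rule semidefinite_norm_bound[of K M])
    show "linear K" unfolding K_def
      by (intro linear_compose_sub D.linear_axioms linear_scale_self)
    show "g (K x) y = g x (K y)" for x y by (simp add: K_def ip_simps D(2))
    show "0 \<le> g x (K x)" if "x \<in> M" for x
      using spectral_gap_lower_bound[OF D \<open>0 < \<delta>\<close> gap, of x] that
      by (simp add: M_def K_def ip_simps self)
    show "K x \<in> M" if "x \<in> M" for x
      using M that DM by (simp add: K_def subspace_diff subspace_scale)
    show "g x (K x) \<le> (G - \<delta>) * (norm x)\<^sup>2" for x
      using G[of x] by (simp add: K_def ip_simps self algebra_simps)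
  qed (use M v in \<open>auto simp: M_def\<close>)
  then have quad: "(norm (D v))\<^sup>2 - (\<delta> + G) * g v (D v) + \<delta> * G * (norm v)\<^sup>2 \<le> 0"
    by (simp add: K_def norm_diff_squared ip_simps self sym[of "D v" v] power_mult_distrib)
      (simp add: algebra_simps power2_eq_square)
  have pos: "0 < \<delta> + G" using \<open>0 < \<delta>\<close> \<open>\<delta> \<le> G\<close> by simp
  define \<alpha> where "\<alpha> = 2 / (\<delta> + G)"
  have \<alpha>: "\<alpha> * (\<delta> + G) = 2" using pos unfolding \<alpha>_def by (metis less_irrefl nonzero_eq_divide_eq)
  have "(norm (v - \<alpha> *\<^sub>R D v))\<^sup>2 = (norm v)\<^sup>2 - \<alpha> * 2 * g v (D v) + \<alpha>\<^sup>2 * (norm (D v))\<^sup>2"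
    by (simp add: norm_diff_squared ip_simps power_mult_distrib)
  also have "\<dots> = (norm v)\<^sup>2 + \<alpha>\<^sup>2 * ((norm (D v))\<^sup>2 - (\<delta> + G) * g v (D v))"
    by (simp only: \<alpha>[symmetric]) (simp add: power2_eq_square algebra_simps)
  also have "\<dots> \<le> (norm v)\<^sup>2 + \<alpha>\<^sup>2 * (- (\<delta> * G * (norm v)\<^sup>2))"
    using quad by (intro add_left_mono mult_left_mono) auto
  also have "\<dots> = (1 - \<alpha>\<^sup>2 * (\<delta> * G)) * (norm v)\<^sup>2" by (simp add: algebra_simps)
  also have "1 - \<alpha>\<^sup>2 * (\<delta> * G) = ((G - \<delta>) / (G + \<delta>))\<^sup>2"
  proof -
    have "1 - \<alpha>\<^sup>2 * (\<delta> * G) = ((G + \<delta>)\<^sup>2 - 4 * (\<delta> * G)) / (G + \<delta>)\<^sup>2"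
      using pos by (simp add: \<alpha>_def power_divide diff_divide_distrib add.commute)
    also have "(G + \<delta>)\<^sup>2 - 4 * (\<delta> * G) = (G - \<delta>)\<^sup>2"
      by (simp add: power2_eq_square algebra_simps)
    finally show ?thesis by (simp only: power_divide)
  qed
  finally have "(norm (v - \<alpha> *\<^sub>R D v))\<^sup>2 \<le> ((G - \<delta>) / (G + \<delta>) * norm v)\<^sup>2"
    by (simp only: power_mult_distrib)
  then have "norm (v - \<alpha> *\<^sub>R D v) \<le> (G - \<delta>) / (G + \<delta>) * norm v"
    by (rule power2_le_imp_le) (use \<open>\<delta> \<le> G\<close> \<open>0 < \<delta>\<close> in simp)
  then show ?thesis by (simp add: \<alpha>_def)
qed

end

subsection \<open>Hilbert spaces over the real or complex numbers\<close>

lemma conjugate_zero [simp]: "conjugate (0::'k::real_or_complex) = 0"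
  using conjugate_add[of "0::'k" 0] by simp

lemma conjugate_of_real [simp]: "conjugate (of_real c :: 'k::real_or_complex) = of_real c"
proof (cases "c = 0")
  case False
  have "conjugate (of_real c :: 'k) * of_real c = of_real c * of_real c"
    by (simp add: conjugate_mult_self power2_eq_square scaleR_conv_of_real)
  then show ?thesis using False by simp
qed simp

lemma norm_conjugate [simp]: "norm (conjugate x) = norm (x::'k::real_or_complex)"
proof (cases "x = 0")
  case False
  have "norm (conjugate x) * norm x = norm x * norm x"
    by (simp add: norm_mult[symmetric] conjugate_mult_self power2_eq_square)
  then show ?thesis using False by simp
qed simp

context hilbert_space
begin

sublocale V: vector_space "scale X"
  by (rule vector_space_scale)

definition re_ip :: "'v \<Rightarrow> 'v \<Rightarrow> real" where
  "re_ip x y = ((norm (x + y))\<^sup>2 - (norm (x - y))\<^sup>2) / 4"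

lemma ip_zero_right [simp]: "ip X x 0 = 0"
  using ip_add_right[of x 0 0] by simp

lemma ip_zero_left [simp]: "ip X 0 x = 0"
  using ip_commute[of 0 x] by simp

lemma ip_minus_right: "ip X x (- y) = - ip X x y"
  using ip_add_right[of x y "- y"] by (simp add: eq_neg_iff_add_eq_0 add.commute)

lemma ip_diff_right: "ip X x (y - z) = ip X x y - ip X x z"
  using ip_add_right[of x y "- z"] by (simp add: ip_minus_right)

lemma ip_add_left: "ip X (x + y) z = ip X x z + ip X y z"
  by (metis ip_add_right ip_commute conjugate_add)

lemma ip_diff_left: "ip X (x - y) z = ip X x z - ip X y z"
  using ip_add_left[of "x - y" y z] by simp

lemma ip_scale_left: "ip X (scale X a x) y = conjugate a * ip X x y"
  by (metis ip_scale_right ip_commute conjugate_mult)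

lemma scaleR_eq_scale: "c *\<^sub>R x = scale X (of_real c) x"
  by (rule scale_of_real[symmetric])

lemma scale_sum_right: "scale X c (sum f I) = (\<Sum>i\<in>I. scale X c (f i))"
  by (rule V.scale_sum_right)

lemma ip_sum_right: "ip X x (sum f I) = (\<Sum>i\<in>I. ip X x (f i))"
  by (induction I rule: infinite_finite_induct) (auto simp: ip_add_right)

lemma ip_sum_left: "ip X (sum f I) x = (\<Sum>i\<in>I. ip X (f i) x)"
  by (induction I rule: infinite_finite_induct) (auto simp: ip_add_left)

lemma of_real_re_ip: "2 * of_real (re_ip x y) = ip X x y + ip X y x"
proof -
  have "(of_real (4 * re_ip x y) :: 'k) = ip X (x + y) (x + y) - ip X (x - y) (x - y)"
    by (simp add: re_ip_def ip_self)
  also have "\<dots> = 2 * (ip X x y + ip X y x)"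
    by (simp add: ip_add_left ip_add_right ip_diff_left ip_diff_right)
  finally have "2 * (2 * (of_real (re_ip x y) :: 'k)) = 2 * (ip X x y + ip X y x)"
    by simp
  then show ?thesis by (simp only: mult_cancel_left) simp
qed

sublocale R: real_inner_product re_ip
proof
  have inj: "a = b" if "2 * (of_real a :: 'k) = 2 * of_real b" for a b :: real
    using that by simp
  fix x y z :: 'v and c :: real
  show "re_ip x (y + z) = re_ip x y + re_ip x z"
    by (rule inj) (simp only: of_real_add distrib_left of_real_re_ip, simp add: ip_add_left ip_add_right)
  show "re_ip x (c *\<^sub>R y) = c * re_ip x y"
  proof (rule inj)
    have "2 * (of_real (c * re_ip x y) :: 'k) = of_real c * (2 * of_real (re_ip x y))"
      by simp
    then show "2 * (of_real (re_ip x (c *\<^sub>R y)) :: 'k) = 2 * of_real (c * re_ip x y)"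
      by (simp only: of_real_re_ip scaleR_eq_scale)
        (simp add: ip_scale_left ip_scale_right distrib_left)
  qed
  show "re_ip x y = re_ip y x" by (simp add: re_ip_def norm_minus_commute add.commute)
  show "re_ip x x = (norm x)\<^sup>2"
    by (simp add: re_ip_def scaleR_2[symmetric] power_mult_distrib)
qed

lemma re_ip_eqI: "ip X x y = of_real c \<Longrightarrow> re_ip x y = c"
proof -
  assume "ip X x y = of_real c"
  then have "2 * (of_real (re_ip x y) :: 'k) = 2 * of_real c"
    unfolding of_real_re_ip by (subst ip_commute[of y x]) simp
  then show ?thesis by simp
qed

lemma re_ip_cong:
  assumes "ip X x y = ip X x' y'"
  shows "re_ip x y = re_ip x' y'"
proof -
  have "2 * (of_real (re_ip x y) :: 'k) = 2 * of_real (re_ip x' y')"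
    unfolding of_real_re_ip by (simp add: assms ip_commute[of y x] ip_commute[of y' x'])
  then show ?thesis by simp
qed

lemma norm_scale: "norm (scale X a x) = norm a * norm x"
proof -
  have "(of_real ((norm (scale X a x))\<^sup>2) :: 'k) = (conjugate a * a) * ip X x x"
    by (simp only: ip_self[symmetric] ip_scale_left ip_scale_right mult_ac)
  also have "\<dots> = of_real ((norm a * norm x)\<^sup>2)"
    by (simp add: conjugate_mult_self ip_self scaleR_conv_of_real power_mult_distrib)
  finally have "(norm (scale X a x))\<^sup>2 = (norm a * norm x)\<^sup>2" by (simp only: of_real_eq_iff)
  then show ?thesis by (rule power2_eq_imp_eq) simp_all
qed

lemma norm_ip_le: "norm (ip X x y) \<le> norm x * norm y"
proof (cases "ip X x y = 0")
  case False
  define z where "z = ip X x y"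
  have "ip X x (scale X (conjugate z) y) = of_real ((norm z)\<^sup>2)"
    by (simp add: ip_scale_right z_def[symmetric] conjugate_mult_self scaleR_conv_of_real)
  then have "(norm z)\<^sup>2 = re_ip x (scale X (conjugate z) y)" by (rule re_ip_eqI[symmetric])
  also have "\<dots> \<le> norm x * norm (scale X (conjugate z) y)"
    using R.Cauchy_Schwarz abs_le_D1 by blast
  finally have "norm z * norm z \<le> norm z * (norm x * norm y)"
    by (simp add: norm_scale power2_eq_square mult_ac)
  then show ?thesis using False by (simp add: z_def)
qed simp

lemma bounded_linear_scale: "bounded_linear (scale X c)"
  by (rule bounded_linear_intro[of _ "norm c"])
    (auto simp: V.scale_right_distrib norm_scale scaleR_eq_scale mult.commute)

lemma bounded_linear_ip_right: "bounded_linear (ip X x)"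
  by (rule bounded_linear_intro[of _ "norm x"])
    (use norm_ip_le in \<open>auto simp: ip_add_right ip_scale_right scaleR_eq_scale
      scaleR_conv_of_real mult.commute[of _ "norm x"]\<close>)

lemma ip_eqI:
  assumes "\<And>y. ip X y v = ip X y w"
  shows "v = w"
proof -
  have "ip X (v - w) (v - w) = 0" using assms by (simp add: ip_diff_right)
  then show ?thesis by (simp add: ip_self)
qed

lemma orthogonal_to_dense:
  assumes "closure (V.span S) = UNIV" "\<And>y. y \<in> S \<Longrightarrow> ip X x y = 0"
  shows "x = 0"
proof -
  have "V.span S \<subseteq> {y. ip X x y = 0}"
    by (rule V.span_minimal) (auto simp: assms(2) V.subspace_def ip_add_right ip_scale_right)
  moreover have "closed {y. ip X x y = 0}"
    by (intro closed_Collect_eq continuous_on_const linear_continuous_on bounded_linear_ip_right)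
  ultimately have "closure (V.span S) \<subseteq> {y. ip X x y = 0}" by (rule closure_minimal)
  then have "ip X x x = 0" by (auto simp: assms(1))
  then show ?thesis by (simp add: ip_self)
qed

theorem Riesz_representation:
  assumes add: "\<And>x y. f (x + y) = f x + f y"
    and scale: "\<And>a x. f (scale X a x) = conjugate a * f x"
    and bound: "\<And>x. norm (f x) \<le> C * norm x"
  shows "\<exists>w. \<forall>y. ip X y w = f y"
proof (cases "\<forall>y. f y = 0")
  case True
  then show ?thesis by (intro exI[of _ 0]) simp
next
  case False
  have "bounded_linear f"
    by (rule bounded_linear_intro[of _ C])
      (auto simp: add scale scaleR_eq_scale bound mult.commute scaleR_conv_of_real)
  then interpret f: bounded_linear f .
  define M where "M = {y. f y = 1}"
  obtain y0 where "f y0 \<noteq> 0" using False by blast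
  then have "f (scale X (conjugate (inverse (f y0))) y0) = 1"
    by (simp add: scale conjugate_conjugate)
  then have "M \<noteq> {}" by (auto simp: M_def)
  moreover have "closed M" unfolding M_def
    by (intro closed_Collect_eq continuous_on_const f.continuous_on continuous_on_id)
  moreover have "convex M"
    by (auto simp: M_def convex_def f.add f.scaleR scaleR_add_left[symmetric])
  ultimately obtain z where z: "f z = 1" "\<And>y. f y = 1 \<Longrightarrow> norm z \<le> norm y"
    using R.exists_min_norm[of M] by (auto simp: M_def)
  have orth: "ip X z h = 0" if "f h = 0" for h
  proof -
    let ?h = "scale X (conjugate (ip X z h)) h"
    have "re_ip z ?h = 0"
      by (rule R.min_norm_orthogonal, rule z(2)) (simp add: f.add f.scaleR scale z(1) that)
    moreover have "ip X z ?h = of_real ((norm (ip X z h))\<^sup>2)"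
      by (simp add: ip_scale_right conjugate_mult_self scaleR_conv_of_real)
    ultimately show ?thesis using re_ip_eqI by fastforce
  qed
  have "z \<noteq> 0" using z(1) f.zero by auto
  have "ip X y (scale X (of_real (1 / (norm z)\<^sup>2)) z) = f y" for y
  proof -
    have "ip X z (y - scale X (conjugate (f y)) z) = 0"
      by (rule orth) (simp add: f.diff scale z(1) conjugate_conjugate)
    then have "ip X z y = conjugate (f y) * of_real ((norm z)\<^sup>2)"
      by (simp add: ip_diff_right ip_scale_right ip_self)
    then have "ip X y z = f y * of_real ((norm z)\<^sup>2)"
      by (subst ip_commute) (simp add: conjugate_mult conjugate_conjugate flip: of_real_power)
    then show ?thesis using \<open>z \<noteq> 0\<close> by (simp add: ip_scale_right)
  qed
  then show ?thesis by blast
qed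

definition orthonormal :: "'v set \<Rightarrow> bool" where
  "orthonormal F \<longleftrightarrow> finite F \<and> (\<forall>x\<in>F. \<forall>y\<in>F. ip X x y = (if x = y then 1 else 0))"

lemma orthonormal_ip_sum:
  assumes "orthonormal F" "e \<in> F"
  shows "ip X e (\<Sum>x\<in>F. scale X (c x) x) = c e"
proof -
  have "ip X e (\<Sum>x\<in>F. scale X (c x) x) = (\<Sum>x\<in>F. if x = e then c e else 0)"
    unfolding ip_sum_right ip_scale_right
    by (rule sum.cong) (use assms in \<open>auto simp: orthonormal_def\<close>)
  then show ?thesis using assms by (simp add: orthonormal_def)
qed

lemma orthonormal_expansion:
  assumes "orthonormal F" "x \<in> V.span F"
  shows "x = (\<Sum>e\<in>F. scale X (ip X e x) e)"
proof -
  obtain c where "x = (\<Sum>e\<in>F. scale X (c e) e)"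
    using assms V.span_finite[of F] by (auto simp: orthonormal_def)
  then show ?thesis using orthonormal_ip_sum[OF assms(1)] by simp
qed

lemma Gram_Schmidt:
  assumes "finite B"
  shows "\<exists>F. orthonormal F \<and> card F \<le> card B \<and> B \<subseteq> V.span F"
  using assms
proof (induction B rule: finite_induct)
  case empty
  then show ?case by (intro exI[of _ "{}"]) (simp add: orthonormal_def)
next
  case (insert b B)
  then obtain F where F: "orthonormal F" "card F \<le> card B" "B \<subseteq> V.span F" by blast
  define s where "s = (\<Sum>e\<in>F. scale X (ip X e b) e)"
  have s: "s \<in> V.span F"
    unfolding s_def by (intro V.span_sum V.span_scale V.span_base)
  show ?case
  proof (cases "b - s = 0")
    case True
    then show ?thesis using F s insert by (intro exI[of _ F]) auto
  next
    case False
    define z where "z = scale X (of_real (1 / norm (b - s))) (b - s)"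
    have orth: "ip X e z = 0" if "e \<in> F" for e
      using orthonormal_ip_sum[OF F(1) that, of "\<lambda>e. ip X e b"]
      by (simp add: z_def ip_scale_right ip_diff_right s_def)
    then have orth': "ip X z e = 0" if "e \<in> F" for e
      using that by (subst ip_commute) simp
    have "norm z = 1" using False by (simp add: z_def norm_scale del: of_real_divide)
    then have "ip X z z = 1" by (simp add: ip_self)
    then have "orthonormal (insert z F)"
      using F(1) orth orth' by (auto simp: orthonormal_def)
    moreover have "b \<in> V.span (insert z F)"
    proof -
      have "b = s + scale X (of_real (norm (b - s))) z"
        using False by (simp add: z_def flip: of_real_mult)
      moreover have "s \<in> V.span (insert z F)" using s V.span_mono[of F "insert z F"] by auto
      ultimately show ?thesis
        by (metis V.span_add V.span_scale V.span_base insertI1)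
    qed
    moreover have "B \<subseteq> V.span (insert z F)" using F(3) V.span_mono[of F "insert z F"] by auto
    moreover have "card (insert z F) \<le> card (insert b B)"
      using F insert by (auto simp: card_insert_if orthonormal_def)
    ultimately show ?thesis by blast
  qed
qed

lemma bounded_operator_add:
  assumes "bounded_operator X A"
  shows "A (x + y) = A x + A y"
  using assms by (simp add: bounded_operator_def bounded_linear.linear linear_add)

lemma bounded_operator_scale:
  assumes "bounded_operator X A"
  shows "A (scale X c x) = scale X c (A x)"
  using assms by (simp add: bounded_operator_def)

lemma bounded_operator_zero:
  assumes "bounded_operator X A"
  shows "A 0 = 0"
  using assms by (simp add: bounded_operator_def bounded_linear.linear linear_0)

lemma bounded_operator_diff:
  assumes "bounded_operator X A"
  shows "A (x - y) = A x - A y"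
  using assms by (simp add: bounded_operator_def bounded_linear.linear linear_diff)

lemma bounded_operator_sum:
  assumes "bounded_operator X A"
  shows "A (sum f I) = (\<Sum>i\<in>I. A (f i))"
  using assms by (simp add: bounded_operator_def bounded_linear.linear linear_sum)

lemma bounded_operator_compose:
  assumes "bounded_operator X A" "bounded_operator X B"
  shows "bounded_operator X (\<lambda>x. A (B x))"
  using assms by (auto simp: bounded_operator_def intro: bounded_linear_compose)

lemma bounded_operator_eqI:
  assumes "bounded_operator X A" "bounded_operator X B"
    and "closure (V.span S) = UNIV" "\<And>y. y \<in> S \<Longrightarrow> A y = B y"
  shows "A = B"
proof -
  have "V.span S \<subseteq> {y. A y = B y}"
    by (rule V.span_minimal)
      (use assms in \<open>auto simp: V.subspace_def bounded_operator_add bounded_operator_scale bounded_operator_zero\<close>)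
  moreover have "closed {y. A y = B y}"
    using assms(1,2) by (intro closed_Collect_eq linear_continuous_on) (auto simp: bounded_operator_def)
  ultimately have "closure (V.span S) \<subseteq> {y. A y = B y}" by (rule closure_minimal)
  then show ?thesis by (auto simp: assms(3))
qed

lemma bounded_operator_extension:
  assumes add: "\<And>x y x' y'. (x, y) \<in> G \<Longrightarrow> (x', y') \<in> G \<Longrightarrow> (x + x', y + y') \<in> G"
    and scale: "\<And>c x y. (x, y) \<in> G \<Longrightarrow> (scale X c x, scale X c y) \<in> G"
    and bound: "\<And>x y. (x, y) \<in> G \<Longrightarrow> norm y \<le> C * norm x"
    and dense: "closure (fst ` G) = UNIV"
  shows "\<exists>B. bounded_operator X B \<and> (\<forall>x y. (x, y) \<in> G \<longrightarrow> B x = y)"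
proof -
  have lip: "dist y y' \<le> C * dist x x'" if "(x, y) \<in> G" "(x', y') \<in> G" for x y x' y'
  proof -
    have "(x + scale X (- 1) x', y + scale X (- 1) y') \<in> G" by (intro add scale that)
    then show ?thesis using bound by (auto simp: dist_norm V.scale_minus_left)
  qed
  define D where "D = fst ` G"
  define F where "F x = (SOME y. (x, y) \<in> G)" for x
  have F: "(x, F x) \<in> G" if "x \<in> D" for x
    using that someI[of "\<lambda>y. (x, y) \<in> G"] unfolding D_def F_def by fastforce
  have F_eq: "F x = y" if "(x, y) \<in> G" for x y
  proof -
    have "x \<in> D" using that by (force simp: D_def)
    then show ?thesis using lip[OF F[OF \<open>x \<in> D\<close>] that] by simp
  qed
  have "\<bar>C\<bar>-lipschitz_on D F"
  proof (rule lipschitz_onI)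
    show "dist (F x) (F y) \<le> \<bar>C\<bar> * dist x y" if "x \<in> D" "y \<in> D" for x y
      using lip[OF F[OF that(1)] F[OF that(2)]] mult_right_mono[OF abs_ge_self[of C] zero_le_dist[of x y]]
      by linarith
  qed simp
  then have "uniformly_continuous_on D F" by (rule lipschitz_on_uniformly_continuous)
  then obtain B where B: "uniformly_continuous_on (closure D) B" "\<And>x. x \<in> D \<Longrightarrow> F x = B x"
    using uniformly_continuous_on_extension_on_closure by metis
  have cont: "continuous_on UNIV B"
    using uniformly_continuous_imp_continuous[OF B(1)] dense by (simp add: D_def)
  have cont_lim: "(\<lambda>n. B (f n)) \<longlonglongrightarrow> B z" if "f \<longlonglongrightarrow> z" for f :: "nat \<Rightarrow> 'v" and z
    using cont that by (auto simp: continuous_on_eq_continuous_at intro: isCont_tendsto_compose)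
  have lim: "\<exists>a. (\<forall>n. (a n, B (a n)) \<in> G) \<and> a \<longlonglongrightarrow> x \<and> (\<lambda>n. B (a n)) \<longlonglongrightarrow> B x" for x
  proof -
    have "x \<in> closure D" by (simp add: D_def dense)
    then obtain a where a: "\<And>n. a n \<in> D" "a \<longlonglongrightarrow> x" unfolding closure_sequential by blast
    have "(\<lambda>n. B (a n)) \<longlonglongrightarrow> B x"
      by (rule cont_lim[OF a(2)])
    then show ?thesis using a F B(2) by (intro exI[of _ a]) auto
  qed
  have BG: "B x = y" if "(x, y) \<in> G" for x y
    using F_eq[OF that] B(2)[of x] that by (force simp: D_def)
  have B_add: "B (x + y) = B x + B y" for x y
  proof -
    obtain a b where ab: "\<And>n. (a n, B (a n)) \<in> G" "a \<longlonglongrightarrow> x" "(\<lambda>n. B (a n)) \<longlonglongrightarrow> B x"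
      "\<And>n. (b n, B (b n)) \<in> G" "b \<longlonglongrightarrow> y" "(\<lambda>n. B (b n)) \<longlonglongrightarrow> B y"
      using lim by metis
    have "B (a n + b n) = B (a n) + B (b n)" for n by (intro BG add ab)
    then have "(\<lambda>n. B (a n + b n)) \<longlonglongrightarrow> B x + B y" using ab by (simp add: tendsto_add)
    moreover have "(\<lambda>n. B (a n + b n)) \<longlonglongrightarrow> B (x + y)"
      by (rule cont_lim[OF tendsto_add[OF ab(2) ab(5)]])
    ultimately show ?thesis using LIMSEQ_unique by blast
  qed
  have B_scale: "B (scale X c x) = scale X c (B x)" for c x
  proof -
    obtain a where a: "\<And>n. (a n, B (a n)) \<in> G" "a \<longlonglongrightarrow> x" "(\<lambda>n. B (a n)) \<longlonglongrightarrow> B x"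
      using lim by metis
    have "B (scale X c (a n)) = scale X c (B (a n))" for n by (intro BG scale a)
    then have "(\<lambda>n. B (scale X c (a n))) \<longlonglongrightarrow> scale X c (B x)"
      using bounded_linear.tendsto[OF bounded_linear_scale a(3)] by simp
    moreover have "(\<lambda>n. B (scale X c (a n))) \<longlonglongrightarrow> B (scale X c x)"
      by (rule cont_lim[OF bounded_linear.tendsto[OF bounded_linear_scale a(2)]])
    ultimately show ?thesis using LIMSEQ_unique by blast
  qed
  have "norm (B x) \<le> C * norm x" for x
  proof -
    obtain a where a: "\<And>n. (a n, B (a n)) \<in> G" "a \<longlonglongrightarrow> x" "(\<lambda>n. B (a n)) \<longlonglongrightarrow> B x"
      using lim by metis
    show ?thesis
      by (rule LIMSEQ_le[OF tendsto_norm[OF a(3)] tendsto_mult_left[OF tendsto_norm[OF a(2)]]])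
        (use bound a(1) in auto)
  qed
  then have "bounded_linear B"
    by (intro bounded_linear_intro[of _ C])
      (auto simp: B_add B_scale scaleR_eq_scale mult.commute)
  then show ?thesis using BG B_scale by (auto simp: bounded_operator_def)
qed

end

subsection \<open>Tensor products and rank\<close>

locale hilbert_tensor_pair = P: hilbert_space P + Q: hilbert_space Q + X: hilbert_space X
  for P :: "('k::real_or_complex, 'p::banach) hilbert_struct"
    and Q :: "('k, 'q::banach) hilbert_struct"
    and X :: "('k, 'v::banach) hilbert_struct" +
  fixes tens2 :: "'p \<Rightarrow> 'q \<Rightarrow> 'v"
  assumes tensor: "hilbert_tensor2 P Q X tens2"
begin

lemma ip_tens2: "ip X (tens2 p q) (tens2 p' q') = ip P p p' * ip Q q q'"
  using tensor by (simp add: hilbert_tensor2_def)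

lemma tens2_dense: "closure (X.V.span {tens2 p q | p q. True}) = UNIV"
  using tensor by (simp add: hilbert_tensor2_def)

lemma tens2_linear_left: "tens2 (scale P c p + p') q = scale X c (tens2 p q) + tens2 p' q"
  using tensor by (simp add: hilbert_tensor2_def)

lemma tens2_linear_right: "tens2 p (scale Q c q + q') = scale X c (tens2 p q) + tens2 p q'"
  using tensor by (simp add: hilbert_tensor2_def)

lemma tens2_add_left: "tens2 (p + p') q = tens2 p q + tens2 p' q"
  using tens2_linear_left[of 1 p p' q] by simp

lemma tens2_add_right: "tens2 p (q + q') = tens2 p q + tens2 p q'"
  using tens2_linear_right[of p 1 q q'] by simp

lemma tens2_zero_left [simp]: "tens2 0 q = 0"
  using tens2_add_left[of 0 0 q] by simp

lemma tens2_zero_right [simp]: "tens2 p 0 = 0"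
  using tens2_add_right[of p 0 0] by simp

lemma tens2_scale_left: "tens2 (scale P c p) q = scale X c (tens2 p q)"
  using tens2_linear_left[of c p 0 q] by simp

lemma tens2_scale_right: "tens2 p (scale Q c q) = scale X c (tens2 p q)"
  using tens2_linear_right[of p c q 0] by simp

lemma tens2_sum_left: "tens2 (sum f I) q = (\<Sum>i\<in>I. tens2 (f i) q)"
  by (induction I rule: infinite_finite_induct) (auto simp: tens2_add_left)

lemma tens2_sum_right: "tens2 p (sum f I) = (\<Sum>i\<in>I. tens2 p (f i))"
  by (induction I rule: infinite_finite_induct) (auto simp: tens2_add_right)

lemma norm_tens2: "norm (tens2 p q) = norm p * norm q"
proof -
  have "(of_real ((norm (tens2 p q))\<^sup>2) :: 'k) = of_real ((norm p * norm q)\<^sup>2)"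
    by (simp only: X.ip_self[symmetric] ip_tens2 P.ip_self Q.ip_self of_real_mult power_mult_distrib)
  then have "(norm (tens2 p q))\<^sup>2 = (norm p * norm q)\<^sup>2" by (simp only: of_real_eq_iff)
  then show ?thesis by (rule power2_eq_imp_eq) simp_all
qed

lemma hilbert_tensor_pair_swap: "hilbert_tensor_pair Q P X (\<lambda>q p. tens2 p q)"
proof -
  have "{tens2 p q | q p. True} = {tens2 p q | p q. True}" by blast
  then have "hilbert_tensor2 Q P X (\<lambda>q p. tens2 p q)"
    using tens2_dense
    by (simp add: hilbert_tensor2_def tens2_linear_left tens2_linear_right ip_tens2 mult.commute)
  then show ?thesis
    by (intro hilbert_tensor_pair.intro hilbert_tensor_pair_axioms.intro
        P.hilbert_space_axioms Q.hilbert_space_axioms X.hilbert_space_axioms)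
qed

definition tensor_sum :: "nat \<Rightarrow> 'v \<Rightarrow> bool" where
  "tensor_sum n v \<longleftrightarrow> (\<exists>p q. v = (\<Sum>i<n. tens2 (p i) (q i)))"

lemma tensor_sum_add:
  assumes "tensor_sum m v" "tensor_sum n w"
  shows "tensor_sum (m + n) (v + w)"
proof -
  obtain p q p' q' where v: "v = (\<Sum>i<m. tens2 (p i) (q i))" and w: "w = (\<Sum>i<n. tens2 (p' i) (q' i))"
    using assms by (auto simp: tensor_sum_def)
  have "v + w = (\<Sum>i<m + n. tens2 (if i < m then p i else p' (i - m)) (if i < m then q i else q' (i - m)))"
    unfolding v w by (induction n) (simp_all add: add.assoc[symmetric])
  then show ?thesis unfolding tensor_sum_def by (intro exI)
qed

lemma tensor_sum_tens2: "tensor_sum 1 (tens2 p q)"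
  unfolding tensor_sum_def by (intro exI[of _ "\<lambda>_. p"] exI[of _ "\<lambda>_. q"]) simp

lemma tensor_sum_zero: "tensor_sum n 0"
  unfolding tensor_sum_def by (intro exI[of _ "\<lambda>_. 0"]) simp

lemma tensor_sum_mono:
  assumes "tensor_sum m v" "m \<le> n"
  shows "tensor_sum n v"
  using tensor_sum_add[OF assms(1) tensor_sum_zero[of "n - m"]] assms(2) by simp

lemma tensor_sum_sum:
  assumes "finite I" "\<And>i. i \<in> I \<Longrightarrow> tensor_sum n (f i)"
  shows "tensor_sum (card I * n) (sum f I)"
  using assms by (induction I rule: finite_induct) (auto intro: tensor_sum_zero tensor_sum_add)

lemma tensor_sum_image:
  assumes B: "\<And>x y. B (x + y) = B x + B y"
    and "\<And>p q. B (tens2 p q) = tens2 (S p) (T q)" and "tensor_sum n v"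
  shows "tensor_sum n (B v)"
proof -
  obtain p q where v: "v = (\<Sum>i<n. tens2 (p i) (q i))" using assms by (auto simp: tensor_sum_def)
  have "B 0 = 0" using B[of 0 0] by simp
  then have "B (sum f {..<m}) = (\<Sum>i<m. B (f i))" for f and m :: nat
    by (induction m) (simp_all add: B)
  then have "B v = (\<Sum>i<n. tens2 (S (p i)) (T (q i)))" by (simp add: v assms)
  then show ?thesis
    unfolding tensor_sum_def by (intro exI[of _ "\<lambda>i. S (p i)"] exI[of _ "\<lambda>i. T (q i)"])
qed

lemma tensor_sum_scale:
  assumes "tensor_sum n v"
  shows "tensor_sum n (scale X c v)"
  by (rule tensor_sum_image[where S = "scale P c" and T = id])
    (use assms in \<open>auto simp: X.V.scale_right_distrib tens2_scale_left\<close>)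

lemma tensor_sums_dense: "closure {v. \<exists>n. tensor_sum n v} = UNIV"
proof -
  have "X.V.subspace {v. \<exists>n. tensor_sum n v}"
    using tensor_sum_add tensor_sum_scale tensor_sum_zero by (auto simp: X.V.subspace_def) blast+
  then have "X.V.span {tens2 p q | p q. True} \<subseteq> {v. \<exists>n. tensor_sum n v}"
    using tensor_sum_tens2 by (intro X.V.span_minimal) blast+
  then show ?thesis using tens2_dense closure_mono by blast
qed

lemma orthonormal_tensor_sum:
  assumes "Q.orthonormal F"
  shows "(norm (\<Sum>e\<in>F. tens2 (p e) e))\<^sup>2 = (\<Sum>e\<in>F. (norm (p e))\<^sup>2)"
proof -
  have "(of_real ((norm (\<Sum>e\<in>F. tens2 (p e) e))\<^sup>2) :: 'k)
      = (\<Sum>e\<in>F. \<Sum>e'\<in>F. ip P (p e) (p e') * (if e = e' then 1 else 0))"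
    unfolding X.ip_self[symmetric] X.ip_sum_left X.ip_sum_right ip_tens2
    by (intro sum.cong refl) (use assms in \<open>auto simp: Q.orthonormal_def\<close>)
  also have "\<dots> = (\<Sum>e\<in>F. ip P (p e) (p e))"
  proof (rule sum.cong[OF refl])
    fix e assume "e \<in> F"
    have "(\<Sum>e'\<in>F. ip P (p e) (p e') * (if e = e' then 1 else 0))
        = (\<Sum>e'\<in>F. if e = e' then ip P (p e) (p e') else 0)"
      by (intro sum.cong) auto
    then show "(\<Sum>e'\<in>F. ip P (p e) (p e') * (if e = e' then 1 else 0)) = ip P (p e) (p e)"
      using assms \<open>e \<in> F\<close> by (simp add: Q.orthonormal_def)
  qed
  also have "\<dots> = of_real (\<Sum>e\<in>F. (norm (p e))\<^sup>2)" by (simp add: P.ip_self)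
  finally show ?thesis by (simp only: of_real_eq_iff)
qed

lemma exists_tensor_left:
  assumes S: "bounded_operator P S"
  shows "\<exists>B. bounded_operator X B \<and> (\<forall>p q. B (tens2 p q) = tens2 (S p) q)"
proof -
  obtain C where C: "\<And>p. norm (S p) \<le> norm p * C" "0 \<le> C"
    using S bounded_linear.nonneg_bounded[of S] by (auto simp: bounded_operator_def)
  define G where "G = {(\<Sum>i<n. tens2 (p i) (q i), \<Sum>i<n. tens2 (S (p i)) (q i)) | (n::nat) p q. True}"
  have "\<exists>B. bounded_operator X B \<and> (\<forall>x y. (x, y) \<in> G \<longrightarrow> B x = y)"
  proof (rule X.bounded_operator_extension)
    fix x y x' y' assume "(x, y) \<in> G" "(x', y') \<in> G"
    then obtain m n :: nat and p q p' q' where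
      xy: "x = (\<Sum>i<m. tens2 (p i) (q i))" "y = (\<Sum>i<m. tens2 (S (p i)) (q i))"
      "x' = (\<Sum>i<n. tens2 (p' i) (q' i))" "y' = (\<Sum>i<n. tens2 (S (p' i)) (q' i))"
      by (auto simp: G_def)
    define p'' q'' where "p'' i = (if i < m then p i else p' (i - m))"
      and "q'' i = (if i < m then q i else q' (i - m))" for i
    have "x + x' = (\<Sum>i<m + n. tens2 (p'' i) (q'' i))"
      unfolding xy by (induction n) (simp_all add: p''_def q''_def add.assoc[symmetric])
    moreover have "y + y' = (\<Sum>i<m + n. tens2 (S (p'' i)) (q'' i))"
      unfolding xy by (induction n) (simp_all add: p''_def q''_def add.assoc[symmetric])
    ultimately show "(x + x', y + y') \<in> G" unfolding G_def by blast
  next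
    fix c x y assume "(x, y) \<in> G"
    then obtain n :: nat and p q where
      "x = (\<Sum>i<n. tens2 (p i) (q i))" "y = (\<Sum>i<n. tens2 (S (p i)) (q i))"
      by (auto simp: G_def)
    then have "scale X c x = (\<Sum>i<n. tens2 (p i) (scale Q c (q i)))"
      "scale X c y = (\<Sum>i<n. tens2 (S (p i)) (scale Q c (q i)))"
      by (simp_all add: tens2_scale_right X.scale_sum_right)
    then show "(scale X c x, scale X c y) \<in> G"
      unfolding G_def by (auto intro!: exI[of _ n] exI[of _ p] exI[of _ "\<lambda>i. scale Q c (q i)"])
  next
    fix x y assume "(x, y) \<in> G"
    then obtain n :: nat and p q where
      xy: "x = (\<Sum>i<n. tens2 (p i) (q i))" "y = (\<Sum>i<n. tens2 (S (p i)) (q i))"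
      by (auto simp: G_def)
    obtain F where F: "Q.orthonormal F" "q ` {..<n} \<subseteq> Q.V.span F"
      using Q.Gram_Schmidt[of "q ` {..<n}"] by auto
    have regroup: "(\<Sum>i<n. tens2 (p' i) (q i)) = (\<Sum>e\<in>F. tens2 (\<Sum>i<n. scale P (ip Q e (q i)) (p' i)) e)" for p'
    proof -
      have "(\<Sum>i<n. tens2 (p' i) (q i)) = (\<Sum>i<n. tens2 (p' i) (\<Sum>e\<in>F. scale Q (ip Q e (q i)) e))"
      proof (rule sum.cong[OF refl])
        fix i assume "i \<in> {..<n}"
        then have "q i \<in> Q.V.span F" using F(2) by auto
        then show "tens2 (p' i) (q i) = tens2 (p' i) (\<Sum>e\<in>F. scale Q (ip Q e (q i)) e)"
          using Q.orthonormal_expansion[OF F(1)] by metis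
      qed
      also have "\<dots> = (\<Sum>e\<in>F. \<Sum>i<n. tens2 (scale P (ip Q e (q i)) (p' i)) e)"
        by (simp add: tens2_sum_right tens2_scale_right tens2_scale_left sum.swap[of _ F])
      finally show ?thesis by (simp add: tens2_sum_left)
    qed
    define r where "r e = (\<Sum>i<n. scale P (ip Q e (q i)) (p i))" for e
    have x: "x = (\<Sum>e\<in>F. tens2 (r e) e)" unfolding xy regroup r_def ..
    have y: "y = (\<Sum>e\<in>F. tens2 (S (r e)) e)"
      unfolding xy regroup r_def by (simp add: P.bounded_operator_sum[OF S] P.bounded_operator_scale[OF S])
    have "(norm y)\<^sup>2 = (\<Sum>e\<in>F. (norm (S (r e)))\<^sup>2)" unfolding y by (rule orthonormal_tensor_sum[OF F(1)])
    also have "\<dots> \<le> (\<Sum>e\<in>F. (norm (r e) * C)\<^sup>2)" by (intro sum_mono power_mono C) simp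
    also have "\<dots> = (C * norm x)\<^sup>2"
      unfolding x power_mult_distrib orthonormal_tensor_sum[OF F(1)]
      by (simp add: sum_distrib_left mult.commute)
    finally show "norm y \<le> C * norm x" by (rule power2_le_imp_le) (use C(2) in simp)
  next
    have "{v. \<exists>n. tensor_sum n v} \<subseteq> fst ` G" by (force simp: G_def tensor_sum_def)
    then show "closure (fst ` G) = UNIV" using tensor_sums_dense closure_mono by blast
  qed
  then obtain B where B: "bounded_operator X B" "\<And>x y. (x, y) \<in> G \<Longrightarrow> B x = y" by blast
  have "(\<Sum>i<1::nat. tens2 p q, \<Sum>i<1::nat. tens2 (S p) q) \<in> G" for p q
    unfolding G_def mem_Collect_eq
    by (intro exI[of _ "1::nat"] exI[of _ "\<lambda>_. p"] exI[of _ "\<lambda>_. q"]) simp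
  then have "B (tens2 p q) = tens2 (S p) q" for p q using B(2) by fastforce
  then show ?thesis using B(1) by blast
qed

lemma tensor_operator:
  assumes S: "bounded_operator P S" and T: "bounded_operator Q T"
  shows "bounded_operator X (tensor_operator X tens2 S T)"
    and "tensor_operator X tens2 S T (tens2 p q) = tens2 (S p) (T q)"
proof -
  interpret swap: hilbert_tensor_pair Q P X "\<lambda>q p. tens2 p q" by (rule hilbert_tensor_pair_swap)
  obtain B where B: "bounded_operator X B" "\<And>p q. B (tens2 p q) = tens2 (S p) q"
    using exists_tensor_left[OF S] by blast
  obtain B' where B': "bounded_operator X B'" "\<And>p q. B' (tens2 p q) = tens2 p (T q)"
    using swap.exists_tensor_left[OF T] by blast
  have "\<exists>!C. bounded_operator X C \<and> (\<forall>p q. C (tens2 p q) = tens2 (S p) (T q))"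
  proof (rule ex1I[of _ "\<lambda>x. B (B' x)"])
    show BB: "bounded_operator X (\<lambda>x. B (B' x)) \<and> (\<forall>p q. B (B' (tens2 p q)) = tens2 (S p) (T q))"
      using B B' by (simp add: X.bounded_operator_compose)
    show "C = (\<lambda>x. B (B' x))"
      if "bounded_operator X C \<and> (\<forall>p q. C (tens2 p q) = tens2 (S p) (T q))" for C
      by (rule X.bounded_operator_eqI[OF _ _ tens2_dense]) (use that BB in auto)
  qed
  from theI'[OF this] show "bounded_operator X (tensor_operator X tens2 S T)"
    and "tensor_operator X tens2 S T (tens2 p q) = tens2 (S p) (T q)"
    unfolding tensor_operator_def by blast+
qed

lemma hs_operator_eqI:
  assumes "\<And>y. ip Q y w = ip X (tens2 p y) v"
  shows "hs_operator Q X tens2 v p = w"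
  unfolding hs_operator_def by (rule the_equality) (auto simp: assms intro: Q.ip_eqI)

lemma ip_hs_operator: "ip Q y (hs_operator Q X tens2 v p) = ip X (tens2 p y) v"
proof -
  have "\<exists>w. \<forall>y. ip Q y w = ip X (tens2 p y) v"
    by (rule Q.Riesz_representation[where C = "norm p * norm v"])
      (use X.norm_ip_le[of "tens2 p _" v] in
        \<open>auto simp: tens2_add_right tens2_scale_right X.ip_add_left X.ip_scale_left norm_tens2 mult_ac\<close>)
  then obtain w where "\<And>y. ip Q y w = ip X (tens2 p y) v" by blast
  then show ?thesis using hs_operator_eqI by metis
qed

theorem tensor_rank_le_iff: "tensor_rank Q X tens2 v \<le> enat n \<longleftrightarrow> tensor_sum n v"
proof
  let ?W = "range (hs_operator Q X tens2 v)"
  assume rank: "tensor_rank Q X tens2 v \<le> enat n"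
  then obtain B0 where B0: "finite B0" "?W \<subseteq> Q.V.span B0" and dim: "Q.V.dim ?W \<le> n"
    by (auto simp: tensor_rank_def Let_def split: if_splits)
  obtain B where B: "B \<subseteq> ?W" "Q.V.independent B" "?W \<subseteq> Q.V.span B" "card B = Q.V.dim ?W"
    using Q.V.basis_exists by blast
  have "finite B" using Q.V.independent_span_bound[OF B0(1) B(2)] B(1) B0(2) by auto
  then obtain F where F: "Q.orthonormal F" "card F \<le> card B" "B \<subseteq> Q.V.span F"
    using Q.Gram_Schmidt by blast
  have "\<exists>p. \<forall>p'. ip P p' p = ip X (tens2 p' e) v" for e
    by (rule P.Riesz_representation[where C = "norm e * norm v"])
      (use X.norm_ip_le[of "tens2 _ e" v] in
        \<open>auto simp: tens2_add_left tens2_scale_left X.ip_add_left X.ip_scale_left norm_tens2 mult_ac\<close>)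
  then obtain p where p: "\<And>e p'. ip P p' (p e) = ip X (tens2 p' e) v" by metis
  have "ip X (v - (\<Sum>e\<in>F. tens2 (p e) e)) y = 0" if y: "y \<in> {tens2 p q | p q. True}" for y
  proof -
    obtain p' q' where y: "y = tens2 p' q'" using y by blast
    have "hs_operator Q X tens2 v p' \<in> Q.V.span F"
      using B(3) Q.V.span_minimal[OF F(3) Q.V.subspace_span] by blast
    then have hs: "hs_operator Q X tens2 v p' = (\<Sum>e\<in>F. scale Q (ip X (tens2 p' e) v) e)"
      by (subst Q.orthonormal_expansion[OF F(1)]) (simp_all add: ip_hs_operator)
    have "ip X (tens2 p' q') v = ip Q q' (hs_operator Q X tens2 v p')"
      by (simp add: ip_hs_operator)
    also have "\<dots> = (\<Sum>e\<in>F. ip X (tens2 p' e) v * ip Q q' e)"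
      unfolding hs by (simp add: Q.ip_sum_right Q.ip_scale_right)
    also have "\<dots> = ip X (tens2 p' q') (\<Sum>e\<in>F. tens2 (p e) e)"
      by (simp add: X.ip_sum_right ip_tens2 p)
    finally have "ip X y (v - (\<Sum>e\<in>F. tens2 (p e) e)) = 0" by (simp add: y X.ip_diff_right)
    then show ?thesis by (subst X.ip_commute) simp
  qed
  then have "v = (\<Sum>e\<in>F. tens2 (p e) e)" using X.orthogonal_to_dense[OF tens2_dense] by force
  moreover have "finite F" using F(1) by (simp add: Q.orthonormal_def)
  ultimately have "tensor_sum (card F * 1) v"
    using tensor_sum_sum[OF _ tensor_sum_tens2] by metis
  then show "tensor_sum n v" by (rule tensor_sum_mono) (use F B dim in simp)
next
  let ?W = "range (hs_operator Q X tens2 v)"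
  assume "tensor_sum n v"
  then obtain p q where v: "v = (\<Sum>i<n. tens2 (p i) (q i))" by (auto simp: tensor_sum_def)
  have "hs_operator Q X tens2 v p' = (\<Sum>i<n. scale Q (ip P p' (p i)) (q i))" for p'
    by (rule hs_operator_eqI)
      (simp add: v X.ip_sum_right ip_tens2 Q.ip_sum_right Q.ip_scale_right)
  then have W: "?W \<subseteq> Q.V.span (q ` {..<n})"
    by (auto intro!: Q.V.span_sum Q.V.span_scale intro: Q.V.span_base)
  have "Q.V.dim ?W \<le> card (q ` {..<n})" using W by (rule Q.V.dim_le_card) simp
  also have "\<dots> \<le> n" using card_image_le[of "{..<n}" q] by simp
  finally show "tensor_rank Q X tens2 v \<le> enat n"
    using W by (auto simp: tensor_rank_def Let_def)
qed

lemma best_error_le: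
  assumes "tensor_sum r v"
  shows "best_error Q X tens2 r u \<le> norm (u - v)"
  unfolding best_error_def
  by (rule cInf_lower) (use assms in \<open>auto simp: tensor_rank_le_iff intro!: bdd_belowI[of _ 0]\<close>)

text \<open>In particular the infimum defining \<open>rank_one_distance\<close> is not the junk value \<open>Inf {}\<close>.\<close>

lemma rank_one_competitor:
  assumes "u \<noteq> 0"
  shows "\<exists>v. ip X (v - u) u = 0 \<and> tensor_sum 1 v"
proof -
  obtain p q where pq: "ip X u (tens2 p q) \<noteq> 0"
    using X.orthogonal_to_dense[OF tens2_dense, of u] assms by blast
  define c where "c = ip X u u / ip X u (tens2 p q)"
  let ?v = "scale X c (tens2 p q)"
  have "ip X u (?v - u) = 0" using pq by (simp add: X.ip_diff_right X.ip_scale_right c_def)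
  then have "ip X (?v - u) u = 0" by (subst X.ip_commute) simp
  then show ?thesis using tensor_sum_scale[OF tensor_sum_tens2] by blast
qed

end

subsection \<open>Approximation rates\<close>

lemma exists_power_bound:
  fixes q :: real and R r :: nat
  assumes q: "0 < q" "q < 1" and "1 \<le> R" "1 \<le> r"
  shows "\<exists>n. R ^ n \<le> r \<and> q ^ n \<le> 1 / q * (1 / real r) powr \<bar>ln q / ln (real R)\<bar>"
proof (cases "R = 1")
  case True
  then show ?thesis using q \<open>1 \<le> r\<close> by (intro exI[of _ 0]) (simp add: field_simps)
next
  case False
  then have "2 \<le> R" using \<open>1 \<le> R\<close> by simp
  then obtain n where n: "R ^ n \<le> r" "r < R ^ (n + 1)"
    using ex_power_ivl1[of R r] \<open>1 \<le> r\<close> by auto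
  have lnR: "0 < ln (real R)" and lnq: "ln q < 0" using \<open>2 \<le> R\<close> q by simp_all
  have "real r \<le> real (R ^ (n + 1))" using n(2) unfolding of_nat_le_iff by simp
  then have "ln (real r) \<le> ln (real (R ^ (n + 1)))" using \<open>1 \<le> r\<close> by (intro ln_mono) auto
  also have "\<dots> = real (n + 1) * ln (real R)" unfolding of_nat_power by (rule ln_realpow)
  finally have "ln (real r) / ln (real R) \<le> real (n + 1)" using lnR by (simp add: divide_le_eq)
  then have "real (n + 1) * ln q \<le> ln (real r) / ln (real R) * ln q"
    using lnq by (intro mult_right_mono_neg) auto
  also have "\<dots> = \<bar>ln q / ln (real R)\<bar> * ln (1 / real r)"
    using lnq lnR \<open>1 \<le> r\<close> by (simp add: ln_div abs_of_neg divide_neg_pos)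
  finally have "exp (real (n + 1) * ln q) \<le> (1 / real r) powr \<bar>ln q / ln (real R)\<bar>"
    using \<open>1 \<le> r\<close> by (simp add: powr_def)
  moreover have "exp (real (n + 1) * ln q) = q ^ n * q"
    using q by (subst exp_of_nat_mult) simp
  ultimately have "q ^ n \<le> 1 / q * (1 / real r) powr \<bar>ln q / ln (real R)\<bar>"
    using q by (simp add: field_simps)
  then show ?thesis using n(1) by blast
qed

context hilbert_tensor_pair
begin

lemma best_error_bound:
  assumes "u \<noteq> 0"
    and q: "0 < q" "q < 1" and "1 \<le> R"
    and \<Phi>: "\<And>v. ip X (v - u) u = 0 \<Longrightarrow>
        ip X (\<Phi> v - u) u = 0 \<and> norm (\<Phi> v - u) \<le> q * norm (v - u)"
    and rank: "\<And>n v. tensor_sum n v \<Longrightarrow> tensor_sum (R * n) (\<Phi> v)"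
    and "1 \<le> r"
  shows "best_error Q X tens2 r u
      \<le> rank_one_distance Q X tens2 u / q * (1 / real r) powr \<bar>ln q / ln (real R)\<bar>"
proof -
  obtain n where n: "R ^ n \<le> r" "q ^ n \<le> 1 / q * (1 / real r) powr \<bar>ln q / ln (real R)\<bar>"
    using exists_power_bound[OF q \<open>1 \<le> R\<close> \<open>1 \<le> r\<close>] by blast
  let ?D = "{norm (v - u) | v. ip X (v - u) u = 0 \<and> tensor_sum 1 v}"
  have dist: "rank_one_distance Q X tens2 u = Inf ?D"
    by (simp add: rank_one_distance_def one_enat_def tensor_rank_le_iff)
  have "?D \<noteq> {}" using rank_one_competitor[OF \<open>u \<noteq> 0\<close>] by blast
  have "best_error Q X tens2 r u / q ^ n \<le> Inf ?D"
  proof (rule cInf_greatest[OF \<open>?D \<noteq> {}\<close>])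
    fix x assume "x \<in> ?D"
    then obtain v where x: "x = norm (v - u)" and v: "ip X (v - u) u = 0" "tensor_sum 1 v" by blast
    have iter: "ip X ((\<Phi> ^^ k) v - u) u = 0 \<and> norm ((\<Phi> ^^ k) v - u) \<le> q ^ k * x
        \<and> tensor_sum (R ^ k) ((\<Phi> ^^ k) v)" for k
    proof (induction k)
      case 0
      then show ?case using v by (simp add: x)
    next
      case (Suc k)
      then have step: "ip X (\<Phi> ((\<Phi> ^^ k) v) - u) u = 0"
        "norm (\<Phi> ((\<Phi> ^^ k) v) - u) \<le> q * norm ((\<Phi> ^^ k) v - u)" using \<Phi> by blast+
      note step(2)
      also have "q * norm ((\<Phi> ^^ k) v - u) \<le> q * (q ^ k * x)"
        using Suc q by (intro mult_left_mono) auto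
      finally show ?case using step(1) Suc rank by simp
    qed
    have "best_error Q X tens2 r u \<le> norm (u - (\<Phi> ^^ n) v)"
      by (rule best_error_le) (use iter n(1) tensor_sum_mono in blast)
    also have "\<dots> \<le> q ^ n * x" using iter[of n] by (simp add: norm_minus_commute)
    finally show "best_error Q X tens2 r u / q ^ n \<le> x"
      using q(1) by (simp add: divide_le_eq mult.commute)
  qed
  then have "best_error Q X tens2 r u \<le> Inf ?D * q ^ n"
    using q(1) by (simp add: divide_le_eq)
  also have "\<dots> \<le> Inf ?D * (1 / q * (1 / real r) powr \<bar>ln q / ln (real R)\<bar>)"
    by (intro mult_left_mono n(2) cInf_greatest[OF \<open>?D \<noteq> {}\<close>]) auto
  finally show ?thesis by (simp add: dist)
qed

lemma tensor_sum_tensor_operator: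
  assumes "bounded_operator P S" "bounded_operator Q T" "tensor_sum n v"
  shows "tensor_sum n (tensor_operator X tens2 S T v)"
  by (rule tensor_sum_image[OF _ _ assms(3)])
    (use tensor_operator[OF assms(1,2)] in \<open>auto simp: X.bounded_operator_add\<close>)

lemma tensor_sum_shifted_sum:
  assumes "finite I" "\<And>i. i \<in> I \<Longrightarrow> bounded_operator P (S i) \<and> bounded_operator Q (T i)"
    and "tensor_sum n v"
  shows "tensor_sum ((card I + 1) * n)
    (scale X c v + scale X a (\<Sum>i\<in>I. tensor_operator X tens2 (S i) (T i) v))"
proof -
  have "tensor_sum (n + card I * n)
    (scale X c v + scale X a (\<Sum>i\<in>I. tensor_operator X tens2 (S i) (T i) v))"
    using assms by (intro tensor_sum_add tensor_sum_scale tensor_sum_sum tensor_sum_tensor_operator) auto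
  then show ?thesis by simp
qed

text \<open>If one factor is the identity, the shift is absorbed into the other factor of the same summand.\<close>

lemma tensor_sum_shifted_identity:
  assumes S: "bounded_operator P S" and T: "bounded_operator Q T" and "S = id \<or> T = id"
    and "tensor_sum n v"
  shows "tensor_sum n (scale X c v + scale X a (tensor_operator X tens2 S T v))"
proof -
  let ?B = "\<lambda>v. scale X c v + scale X a (tensor_operator X tens2 S T v)"
  have add: "?B (x + y) = ?B x + ?B y" for x y
    by (simp add: X.bounded_operator_add[OF tensor_operator(1)[OF S T]] X.V.scale_right_distrib)
  show ?thesis
  proof (cases "S = id")
    case True
    show ?thesis
      by (rule tensor_sum_image[where S = id and T = "\<lambda>q. scale Q c q + scale Q a (T q)", OF add _ assms(4)])
        (simp only: tensor_operator(2)[OF S T], simp add: True tens2_add_right tens2_scale_right)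
  next
    case False
    then have "T = id" using assms(3) by blast
    show ?thesis
      by (rule tensor_sum_image[where S = "\<lambda>p. scale P c p + scale P a (S p)" and T = id, OF add _ assms(4)])
        (simp only: tensor_operator(2)[OF S T], simp add: \<open>T = id\<close> tens2_add_left tens2_scale_left)
  qed
qed

lemma tensor_sum_shifted_sum_identity:
  assumes "finite I" "\<And>i. i \<in> I \<Longrightarrow> bounded_operator P (S i) \<and> bounded_operator Q (T i)"
    and j: "j \<in> I" "S j = id \<or> T j = id" and v: "tensor_sum n v"
  shows "tensor_sum (card I * n)
    (scale X c v + scale X a (\<Sum>i\<in>I. tensor_operator X tens2 (S i) (T i) v))"
proof -
  let ?C = "\<lambda>i. tensor_operator X tens2 (S i) (T i) v"
  have "scale X c v + scale X a (\<Sum>i\<in>I. ?C i)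
      = (scale X c v + scale X a (?C j)) + scale X a (\<Sum>i\<in>I - {j}. ?C i)"
    using assms(1) j(1) by (simp add: sum.remove X.V.scale_right_distrib)
  moreover have "tensor_sum (n + card (I - {j}) * n)
      ((scale X c v + scale X a (?C j)) + scale X a (\<Sum>i\<in>I - {j}. ?C i))"
    using assms by (intro tensor_sum_add tensor_sum_scale tensor_sum_sum
        tensor_sum_tensor_operator tensor_sum_shifted_identity) auto
  moreover have "n + card (I - {j}) * n = card I * n"
    using card.remove[OF assms(1) j(1)] by simp
  ultimately show ?thesis by (simp only:)
qed

end

context hilbert_space
begin

lemma bounded_below_off_spectrum:
  assumes "z \<notin> spectrum X A"
  shows "\<exists>c>0. \<forall>x. c * norm x \<le> norm (A x - scale X z x)"
proof -
  obtain B where B: "bounded_operator X B" "\<And>x. B (A x - scale X z x) = x"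
    using assms by (auto simp: spectrum_def)
  obtain K where K: "K > 0" "\<And>x. norm (B x) \<le> norm x * K"
    using B(1) bounded_linear.pos_bounded[of B] by (auto simp: bounded_operator_def)
  have "norm x \<le> norm (A x - scale X z x) * K" for x
    using K(2)[of "A x - scale X z x"] by (simp add: B(2))
  then show ?thesis using K(1) by (intro exI[of _ "1 / K"]) (simp add: divide_le_eq)
qed

lemma one_dimensional_subset_span:
  assumes "V.dim W = 1" "u \<in> W" "u \<noteq> 0" "w \<in> W"
  shows "\<exists>k. w = scale X k u"
proof -
  obtain B where B: "W \<subseteq> V.span B" "card B = 1" using V.basis_exists assms(1) by metis
  then obtain b where "W \<subseteq> V.span {b}" by (metis card_1_singletonE)
  then obtain k l where k: "u = scale X k b" and l: "w = scale X l b"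
    using assms(2,4) unfolding V.span_singleton by blast
  have "k \<noteq> 0" using k assms(3) by auto
  then show ?thesis using k l by (intro exI[of _ "l / k"]) simp
qed

lemma eigenvector_complement_contraction:
  assumes A: "bounded_operator X A" "self_adjoint X A"
    and simple: "V.dim (eigenspace X A (of_real lam1)) = 1"
    and bounds: "\<And>v. ip X v (A v) \<in> of_real ` {lam1 * (norm v)\<^sup>2 .. \<Gamma> * (norm v)\<^sup>2}"
    and spectrum: "spectrum X A - {of_real lam1} \<subseteq> of_real ` {lam2..\<Gamma>}"
    and lam: "lam1 < lam2" "lam2 \<le> \<Gamma>"
    and u: "u \<noteq> 0" "A u = scale X (of_real lam1) u"
    and v: "ip X v u = 0"
  shows "norm (v - (2 / (lam2 - lam1 + (\<Gamma> - lam1))) *\<^sub>R (A v - lam1 *\<^sub>R v))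
    \<le> (\<Gamma> - lam2) / (\<Gamma> - lam1 + (lam2 - lam1)) * norm v"
proof -
  define D where "D x = A x - lam1 *\<^sub>R x" for x
  have form: "re_ip x (D x) \<in> {0 .. (\<Gamma> - lam1) * (norm x)\<^sup>2}" for x
  proof -
    obtain s where s: "ip X x (A x) = of_real s" "s \<in> {lam1 * (norm x)\<^sup>2 .. \<Gamma> * (norm x)\<^sup>2}"
      using bounds[of x] by blast
    then show ?thesis
      by (simp add: D_def R.ip_simps R.self re_ip_eqI[OF s(1)] algebra_simps)
  qed
  have "norm (v - (2 / (lam2 - lam1 + (\<Gamma> - lam1))) *\<^sub>R D v)
    \<le> (\<Gamma> - lam1 - (lam2 - lam1)) / (\<Gamma> - lam1 + (lam2 - lam1)) * norm v"
  proof (rule R.spectral_gap_contraction)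
    show "bounded_linear D" unfolding D_def
      using A(1) by (intro bounded_linear_sub bounded_linear_scaleR_right) (simp add: bounded_operator_def)
    show "re_ip (D x) y = re_ip x (D y)" for x y
    proof -
      have "re_ip (A x) y = re_ip x (A y)" by (rule re_ip_cong) (use A(2) in \<open>simp add: self_adjoint_def\<close>)
      then show ?thesis by (simp add: D_def R.ip_simps)
    qed
    show "0 \<le> re_ip x (D x)" "re_ip x (D x) \<le> (\<Gamma> - lam1) * (norm x)\<^sup>2" for x
      using form[of x] by auto
    show "\<exists>c>0. \<forall>x. c * norm x \<le> norm (D x - s *\<^sub>R x)" if s: "0 < s" "s < lam2 - lam1" for s
    proof -
      have "of_real (lam1 + s) \<notin> spectrum X A"
      proof
        assume in_spec: "of_real (lam1 + s) \<in> spectrum X A"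
        have "(of_real (lam1 + s) :: 'k) \<noteq> of_real lam1" unfolding of_real_eq_iff using s by simp
        then obtain y where "y \<in> {lam2..\<Gamma>}" "(of_real (lam1 + s) :: 'k) = of_real y"
          using in_spec spectrum by blast
        then show False using s unfolding of_real_eq_iff by simp
      qed
      moreover have "A x - scale X (of_real (lam1 + s)) x = D x - s *\<^sub>R x" for x
        unfolding D_def scale_of_real scaleR_add_left by simp
      ultimately show ?thesis using bounded_below_off_spectrum[of "of_real (lam1 + s)" A] by simp
    qed
    show "re_ip v w = 0" if "D w = 0" for w
    proof -
      have "w \<in> eigenspace X A (of_real lam1)" "u \<in> eigenspace X A (of_real lam1)"
        using that u(2) by (simp_all add: D_def eigenspace_def scale_of_real)
      then obtain k where "w = scale X k u" using one_dimensional_subset_span[OF simple _ u(1)] by blast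
      then show ?thesis using v re_ip_eqI[of v w 0] by (simp add: ip_scale_right)
    qed
  qed (use lam in auto)
  then show ?thesis by (simp add: D_def)
qed

end

theorem theorem3:
  fixes E :: "('k::real_or_complex, 'a::banach) hilbert_struct"
    and P :: "('k, 'p::banach) hilbert_struct"
    and Q :: "('k, 'q::banach) hilbert_struct"
    and X :: "('k, 'v::banach) hilbert_struct"
    and H :: "nat \<Rightarrow> 'a set"
    and tens :: "(nat \<Rightarrow> 'a) \<Rightarrow> 'v"
    and tens_t :: "(nat \<Rightarrow> 'a) \<Rightarrow> 'p"
    and tens_tc :: "(nat \<Rightarrow> 'a) \<Rightarrow> 'q"
    and tens2 :: "'p \<Rightarrow> 'q \<Rightarrow> 'v"
    and A :: "'v \<Rightarrow> 'v"
    and S :: "nat \<Rightarrow> 'p \<Rightarrow> 'p"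
    and T :: "nat \<Rightarrow> 'q \<Rightarrow> 'q"
    and u :: 'v
    and d rA :: nat
    and t tc :: "nat set"
    and lam1 lam2 \<Gamma> \<delta> \<Delta> q :: real
  assumes "d \<ge> 2"
    and "hilbert_space E"
    and "\<forall>\<mu>\<in>{1..d}. closed (H \<mu>) \<and> module.subspace (scale E) (H \<mu>)"
    and "hilbert_space X"
    and "hilbert_tensor E {1..d} H X tens"
    and "bounded_operator X A"
    and "self_adjoint X A"
    and "of_real lam1 \<in> spectrum X A"
    and "\<forall>z\<in>spectrum X A. \<exists>s\<ge>lam1. z = of_real s"
    and "vector_space.dim (scale X) (eigenspace X A (of_real lam1)) = 1"
    and "\<forall>v. ip X v (A v) \<in> of_real ` {lam1 * (norm v)\<^sup>2 .. \<Gamma> * (norm v)\<^sup>2}"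
    and "spectrum X A - {of_real lam1} \<subseteq> of_real ` {lam2..\<Gamma>}"
    and "lam1 < lam2"
    and "lam2 < \<Gamma>"
    and "\<delta> = lam2 - lam1"
    and "\<Delta> = \<delta> / (\<Gamma> - lam1)"
    and "q = (1 - \<Delta>) / (1 + \<Delta>)"
    and "t \<subseteq> {1..d}"
    and "0 < card t"
    and "card t < d"
    and "tc = {1..d} - t"
    and "hilbert_space P"
    and "hilbert_tensor E t H P tens_t"
    and "hilbert_space Q"
    and "hilbert_tensor E tc H Q tens_tc"
    and "hilbert_tensor2 P Q X tens2"
    and "\<forall>x\<in>Pi {1..d} H. tens2 (tens_t x) (tens_tc x) = tens x"
    and "\<forall>i\<in>{1..rA}. bounded_operator P (S i) \<and> bounded_operator Q (T i)"
    and "A = (\<lambda>v. \<Sum>i=1..rA. tensor_operator X tens2 (S i) (T i) v)"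
    and "u \<noteq> 0"
    and "A u - scale X (of_real lam1) u = 0"
  shows "(\<forall>r\<ge>1. best_error Q X tens2 r u
             \<le> rank_one_distance Q X tens2 u / q
                 * (1 / real r) powr \<bar>ln q / ln (real (rA + 1))\<bar>) \<and>
         ((\<exists>i\<in>{1..rA}. S i = id \<or> T i = id) \<and> rA > 1 \<longrightarrow>
          (\<forall>r\<ge>1. best_error Q X tens2 r u
             \<le> rank_one_distance Q X tens2 u / q
                 * (1 / real r) powr \<bar>ln q / ln (real rA)\<bar>))"
proof -
  interpret hilbert_tensor_pair P Q X tens2
    by (intro hilbert_tensor_pair.intro hilbert_tensor_pair_axioms.intro assms)
  define \<alpha> where "\<alpha> = 2 / (lam2 - lam1 + (\<Gamma> - lam1))"
  define \<Phi> where "\<Phi> v = v - \<alpha> *\<^sub>R (A v - lam1 *\<^sub>R v)" for v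
  have Au: "A u = scale X (of_real lam1) u" using assms(31) by simp
  have q: "q = (\<Gamma> - lam2) / (\<Gamma> - lam1 + (lam2 - lam1))"
  proof -
    have "0 < \<Gamma> - lam1" using assms(13,14) by simp
    then have "q = ((\<Gamma> - lam1) * (1 - \<Delta>)) / ((\<Gamma> - lam1) * (1 + \<Delta>))" by (simp add: assms(17))
    moreover have "(\<Gamma> - lam1) * \<Delta> = lam2 - lam1" using \<open>0 < \<Gamma> - lam1\<close> by (simp add: assms(15,16))
    ultimately show ?thesis by (simp add: right_diff_distrib distrib_left)
  qed
  have q01: "0 < q" "q < 1" using assms(13,14) by (simp_all add: q)
  have contraction: "ip X (\<Phi> v - u) u = 0 \<and> norm (\<Phi> v - u) \<le> q * norm (v - u)"
    if "ip X (v - u) u = 0" for v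
  proof
    have \<Phi>: "\<Phi> v - u = (v - u) - \<alpha> *\<^sub>R (A (v - u) - lam1 *\<^sub>R (v - u))"
      by (simp add: \<Phi>_def X.bounded_operator_diff[OF assms(6)] Au X.scale_of_real algebra_simps)
    show "norm (\<Phi> v - u) \<le> q * norm (v - u)"
      unfolding \<Phi> \<alpha>_def q
      by (rule X.eigenvector_complement_contraction)
        (use assms(6,7,10-14,30) Au that in auto)
    have "ip X (w - \<alpha> *\<^sub>R (A w - lam1 *\<^sub>R w)) u = 0" if "ip X w u = 0" for w
    proof -
      have "ip X (A w) u = 0" using assms(7) that by (simp add: self_adjoint_def Au X.ip_scale_right)
      then show ?thesis by (simp add: X.scaleR_eq_scale X.ip_diff_left X.ip_scale_left that)
    qed
    then show "ip X (\<Phi> v - u) u = 0" unfolding \<Phi> using that .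
  qed
  let ?C = "\<lambda>i. tensor_operator X tens2 (S i) (T i)"
  have \<Phi>: "\<Phi> v = scale X (of_real (1 + \<alpha> * lam1)) v + scale X (of_real (- \<alpha>)) (\<Sum>i=1..rA. ?C i v)" for v
  proof -
    have "A v = (\<Sum>i=1..rA. ?C i v)" using assms(29) by (rule fun_cong)
    then show ?thesis
      unfolding \<Phi>_def X.scale_of_real by (simp add: algebra_simps)
  qed
  have "tensor_sum ((rA + 1) * n) (\<Phi> v)" if "tensor_sum n v" for n v
    unfolding \<Phi> using tensor_sum_shifted_sum[of "{1..rA}" S T n v] assms(28) that
    unfolding card_atLeastAtMost diff_Suc_1 by blast
  note bound = best_error_bound[OF assms(30) q01 _ contraction this]
  have bound_id: "best_error Q X tens2 r u
      \<le> rank_one_distance Q X tens2 u / q * (1 / real r) powr \<bar>ln q / ln (real rA)\<bar>"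
    if "\<exists>i\<in>{1..rA}. S i = id \<or> T i = id" "1 < rA" "1 \<le> r" for r
  proof (rule best_error_bound[OF assms(30) q01 _ contraction])
    obtain j where j: "j \<in> {1..rA}" "S j = id \<or> T j = id"
      using \<open>\<exists>i\<in>{1..rA}. S i = id \<or> T i = id\<close> by blast
    show "tensor_sum (rA * n) (\<Phi> v)" if "tensor_sum n v" for n v
      unfolding \<Phi> using tensor_sum_shifted_sum_identity[of "{1..rA}" S T j n v] assms(28) that j
      unfolding card_atLeastAtMost diff_Suc_1 by blast
  qed (use that in auto)
  show ?thesis using bound[OF le_add2] bound_id by blast
qed

end
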